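(* Let $1\le p<\infty$, let $\Omega$ be a compact Hausdorff space, let $X,Y$ be Banach spaces and let $T:C(\Omega,X)\to Y$ be a strongly bounded operator with extension $\hat T:B(\Omega,X)\to Y$. Then $T$ is Dunford-Pettis $p$-convergent if and only if $\hat T$ is Dunford-Pettis $p$-convergent.
   Context: A sequence $(x_n)_n$ in a Banach space $X$ is weakly $p$-summable if $(x^*(x_n))_n\in\ell_p$ for every $x^*\in X^*$. A bounded set $K\subseteq X$ is a Dunford-Pettis set if every weakly null sequence $(x_n^* )_n$ in $X^*$ converges to $0$ uniformly on $K$. A bounded linear operator between Banach spaces is Dunford-Pettis $p$-convergent if it takes every weakly $p$-summable sequence whose set of terms is a Dunford-Pettis set to a norm null sequence. $C(\Omega,X)$ is the space of continuous functions $\Omega\to X$ with the supremum norm; $\Sigma$ is the $\sigma$-algebra of Borel subsets of $\Omega$; $B(\Omega,X)$ is the space of all bounded $\Sigma$-measurable functions $\Omega\to X$ with separable range, with the supremum norm, regarded as a subspace of $C(\Omega,X)^{**}$ via integration against the elements of $C(\Omega,X)^*$ (regular $X^*$-valued Borel measures of bounded variation). Every bounded linear operator $T:C(\Omega,X)\to Y$ has a representing measure $m:\Sigma\to L(X,Y^{**})$ of finite semivariation $\tilde m$ with $T(f)=\int_\Omega f\,dm$, where $\tilde m(A)=\sup\|\sum_i m(A_i)x_i\|$ over finite Borel partitions $(A_i)$ of $A$ and $x_i$ in the unit ball of $X$. $T$ is strongly bounded if $m$ is, i.e. $\tilde m(A_n)\to0$ for every pairwise disjoint sequence $(A_n)$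 in $\Sigma$; in this case $m$ takes values in $L(X,Y)$. For strongly bounded $T$, $\hat T:B(\Omega,X)\to Y$ is the restriction of $T^{**}$ to $B(\Omega,X)$, i.e. $\hat T(f)=\int_\Omega f\,dm$. *)

theory Defs
  imports "HOL-Analysis.Analysis"
begin

section \<open>Dunford-Pettis \<open>p\<close>-convergent operators\<close>

definition weakly_p_summable :: "real \<Rightarrow> (nat \<Rightarrow> 'a::banach) \<Rightarrow> bool" where
  "weakly_p_summable p x \<longleftrightarrow>
     (\<forall>\<phi> :: 'a \<Rightarrow>\<^sub>L real. summable (\<lambda>n. \<bar>blinfun_apply \<phi> (x n)\<bar> powr p))"

definition weakly_null :: "(nat \<Rightarrow> 'a::banach) \<Rightarrow> bool" where
  "weakly_null x \<longleftrightarrow> (\<forall>\<phi> :: 'a \<Rightarrow>\<^sub>L real. (\<lambda>n. blinfun_apply \<phi> (x n)) \<longlonglongrightarrow> 0)"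

definition Dunford_Pettis_set :: "'a::banach set \<Rightarrow> bool" where
  "Dunford_Pettis_set K \<longleftrightarrow> bounded K \<and>
     (\<forall>\<phi> :: nat \<Rightarrow> 'a \<Rightarrow>\<^sub>L real. weakly_null \<phi> \<longrightarrow>
        uniform_limit K (\<lambda>n. blinfun_apply (\<phi> n)) (\<lambda>_. 0) sequentially)"

definition DP_p_convergent :: "real \<Rightarrow> ('a::banach \<Rightarrow>\<^sub>L 'b::banach) \<Rightarrow> bool" where
  "DP_p_convergent p T \<longleftrightarrow>
     (\<forall>x. weakly_p_summable p x \<and> Dunford_Pettis_set (range x) \<longrightarrow>
        (\<lambda>n. blinfun_apply T (x n)) \<longlonglongrightarrow> 0)"


section \<open>Completeness of the space of bounded continuous functions\<close>

text \<open>
  For compact \<open>\<Omega>\<close> every continuous function on \<open>\<Omega>\<close> is bounded, so \<open>C(\<Omega>, X)\<close> is the library type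
  of bounded continuous functions. The library proves its completeness only for metric \<open>\<Omega>\<close>.
\<close>

instance bcontfun :: (topological_space, complete_space) complete_space
proof
  fix f :: "nat \<Rightarrow> ('a, 'b) bcontfun"
  assume "Cauchy f"
  then obtain g where "uniform_limit UNIV (\<lambda>n. apply_bcontfun (f n)) g sequentially"
    using uniformly_convergent_eq_cauchy[of "\<lambda>_. True" "\<lambda>n. apply_bcontfun (f n)"]
    unfolding Cauchy_def uniform_limit_sequentially_iff
    by (metis dist_fun_lt_imp_dist_val_lt)
  from uniform_limit_bcontfunE[OF this sequentially_bot]
  obtain l' where "g = apply_bcontfun l'" "f \<longlonglongrightarrow> l'" by metis
  then show "convergent f"
    by (intro convergentI)
qed

instance bcontfun :: (topological_space, banach) banach ..


section \<open>Bounded Borel functions with separable range\<close>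

lemma separable_space_subset_closure_iff:
  fixes S :: "'a::metric_space set"
  shows "separable_space (top_of_set S) \<longleftrightarrow> (\<exists>D. countable D \<and> S \<subseteq> closure D)"
proof
  assume "separable_space (top_of_set S)"
  then show "\<exists>D. countable D \<and> S \<subseteq> closure D"
    unfolding separable_space_def
    by (auto simp: closure_of_subtopology)
next
  assume "\<exists>D. countable D \<and> S \<subseteq> closure D"
  then obtain D where D: "countable D" "S \<subseteq> closure D" by blast
  define pick where "pick = (\<lambda>(d, n). SOME s. s \<in> S \<and> dist s d < inverse (real (Suc n)))"
  define I where "I = {(d, n). d \<in> D \<and> (\<exists>s. s \<in> S \<and> dist s d < inverse (real (Suc n)))}"
  have pick: "pick (d, n) \<in> S \<and> dist (pick (d, n)) d < inverse (real (Suc n))" if "(d, n) \<in> I" for d n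
  proof -
    have "\<exists>s. s \<in> S \<and> dist s d < inverse (real (Suc n))" using that by (auto simp: I_def)
    from someI_ex[OF this] show ?thesis by (simp add: pick_def)
  qed
  have "I \<subseteq> D \<times> UNIV" by (auto simp: I_def)
  then have cI: "countable I"
    by (meson D(1) countable_SIGMA countableI_type countable_subset)
  have "S \<subseteq> closure (pick ` I)"
  proof
    fix s assume s: "s \<in> S"
    show "s \<in> closure (pick ` I)"
    proof (subst closure_approachable, intro allI impI)
      fix e :: real assume "e > 0"
      then obtain n where n: "inverse (real (Suc n)) < e / 2"
        using reals_Archimedean[of "e / 2"] by auto
      have "s \<in> closure D" using s D by auto
      then obtain d where d: "d \<in> D" "dist d s < inverse (real (Suc n))"
        unfolding closure_approachable by (meson inverse_positive_iff_positive of_nat_0_less_iff zero_less_Suc)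
      have I: "(d, n) \<in> I" using d s by (auto simp: I_def dist_commute)
      have "dist (pick (d, n)) s \<le> dist (pick (d, n)) d + dist d s" by (rule dist_triangle)
      also have "\<dots> < e" using pick[OF I] d n by linarith
      finally show "\<exists>y\<in>pick ` I. dist y s < e" using I by blast
    qed
  qed
  moreover have "pick ` I \<subseteq> S" using pick by auto
  ultimately show "separable_space (top_of_set S)"
    unfolding separable_space_def using cI
    by (intro exI[of _ "pick ` I"]) (auto simp: closure_of_subtopology Int_absorb1)
qed

definition "bmeasfun =
  {f :: 'w::topological_space \<Rightarrow> 'x::metric_space.
     f \<in> borel_measurable borel \<and> bounded (range f) \<and> separable_space (top_of_set (range f))}"

lemma const_bmeasfun: "(\<lambda>_. c) \<in> bmeasfun"
  by (auto simp: bmeasfun_def separable_space_subset_closure_iff image_def intro!: exI[of _ "{c}"])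

typedef (overloaded) ('w, 'x) bmeasfun (\<open>(_ \<Rightarrow>\<^sub>B /_)\<close> [22, 21] 21) =
  "bmeasfun :: ('w::topological_space \<Rightarrow> 'x::metric_space) set"
  morphisms apply_bmeasfun Bmeasfun
  using const_bmeasfun by blast

setup_lifting type_definition_bmeasfun

lemma bmeasfun_eqI: "(\<And>t. apply_bmeasfun f t = apply_bmeasfun g t) \<Longrightarrow> f = g"
  by transfer auto

lemma bmeasfun_scaleR:
  fixes f :: "'w::topological_space \<Rightarrow> 'x::real_normed_vector"
  assumes "f \<in> bmeasfun"
  shows "(\<lambda>t. c *\<^sub>R f t) \<in> bmeasfun"
proof -
  obtain D where D: "countable D" "range f \<subseteq> closure D"
    using assms by (auto simp: bmeasfun_def separable_space_subset_closure_iff)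
  have "range (\<lambda>t. c *\<^sub>R f t) \<subseteq> (\<lambda>x. c *\<^sub>R x) ` closure D" using D by auto
  also have "\<dots> \<subseteq> closure ((\<lambda>x. c *\<^sub>R x) ` D)"
    by (rule continuous_image_closure_subset[of UNIV]) (auto intro!: continuous_intros)
  finally have "separable_space (top_of_set (range (\<lambda>t. c *\<^sub>R f t)))"
    unfolding separable_space_subset_closure_iff using D(1) by blast
  moreover have "(\<lambda>t. c *\<^sub>R f t) \<in> borel_measurable borel"
  proof -
    have "(\<lambda>x :: 'x. c *\<^sub>R x) \<in> borel_measurable borel"
      by (intro borel_measurable_continuous_onI continuous_intros)
    from measurable_compose[OF _ this, of f borel] show ?thesis
      using assms by (auto simp: bmeasfun_def)
  qed
  ultimately show ?thesis using assms by (auto simp: bmeasfun_def intro: bounded_scaleR_comp)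
qed

text \<open>
  The library's measurability of sums requires a second countable codomain; here the separability of
  the two ranges takes its place.
\<close>

lemma bmeasfun_plus:
  fixes f g :: "'w::topological_space \<Rightarrow> 'x::real_normed_vector"
  assumes f: "f \<in> bmeasfun" and g: "g \<in> bmeasfun"
  shows "(\<lambda>t. f t + g t) \<in> bmeasfun"
proof -
  obtain D where D: "countable D" "range f \<subseteq> closure D"
    using f by (auto simp: bmeasfun_def separable_space_subset_closure_iff)
  obtain E where E: "countable E" "range g \<subseteq> closure E"
    using g by (auto simp: bmeasfun_def separable_space_subset_closure_iff)
  have fm: "f \<in> borel_measurable borel" and gm: "g \<in> borel_measurable borel"
    using f g by (auto simp: bmeasfun_def)
  let ?r = "\<lambda>n. inverse (real (Suc n))"
  have approx: "\<exists>d\<in>D. \<exists>e\<in>E. dist (f t) d < r \<and> dist (g t) e < r" if "r > 0" for t r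
  proof -
    have "f t \<in> closure D" "g t \<in> closure E" using D E by auto
    then show ?thesis using that unfolding closure_approachable by (metis dist_commute)
  qed
  have "range (\<lambda>t. f t + g t) \<subseteq> closure ((\<lambda>(d, e). d + e) ` (D \<times> E))"
  proof (safe, subst closure_approachable, intro allI impI)
    fix t and r :: real assume "r > 0"
    then obtain d e where de: "d \<in> D" "e \<in> E" "dist (f t) d < r/2" "dist (g t) e < r/2"
      using approx[of "r/2" t] by auto
    have "dist (d + e) (f t + g t) \<le> dist (f t) d + dist (g t) e"
      by (metis dist_commute dist_triangle_add)
    then show "\<exists>y\<in>(\<lambda>(d, e). d + e) ` (D \<times> E). dist y (f t + g t) < r"
      using de by (intro bexI[of _ "d + e"]) auto
  qed
  moreover have "countable ((\<lambda>(d, e). d + e) ` (D \<times> E))"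
    using D E by auto
  ultimately have "separable_space (top_of_set (range (\<lambda>t. f t + g t)))"
    unfolding separable_space_subset_closure_iff by blast
  moreover have "(\<lambda>t. f t + g t) \<in> borel_measurable borel"
  proof (rule borel_measurableI)
    fix U :: "'x set" assume U: "open U"
    define J where "J = {(d, e, n). d \<in> D \<and> e \<in> E \<and> (\<forall>x y. dist x d < ?r n \<longrightarrow> dist y e < ?r n \<longrightarrow> x + y \<in> U)}"
    have "J \<subseteq> D \<times> E \<times> UNIV" by (auto simp: J_def)
    then have cJ: "countable J"
      by (meson D(1) E(1) countable_SIGMA countableI_type countable_subset)
    let ?R = "\<lambda>(d, e, n). (f -` ball d (?r n)) \<inter> (g -` ball e (?r n))"
    have "(\<lambda>t. f t + g t) -` U = (\<Union>j\<in>J. ?R j)"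
    proof (intro set_eqI iffI)
      fix t assume "t \<in> (\<lambda>t. f t + g t) -` U"
      then obtain e0 where e0: "e0 > 0" "ball (f t + g t) e0 \<subseteq> U"
        using U openE by auto
      obtain n where n: "?r n < e0 / 4" using reals_Archimedean[of "e0 / 4"] e0 by auto
      obtain d e where de: "d \<in> D" "e \<in> E" "dist (f t) d < ?r n" "dist (g t) e < ?r n"
        using approx[of "?r n" t] by auto
      have "x + y \<in> U" if "dist x d < ?r n" "dist y e < ?r n" for x y
      proof -
        have "dist (f t) x < e0 / 2" "dist (g t) y < e0 / 2"
          using that de n dist_triangle2[of "f t" x d] dist_triangle2[of "g t" y e] by linarith+
        then have "dist (f t + g t) (x + y) < e0"
          using dist_triangle_add[of "f t" "g t" x y] by linarith
        then show ?thesis using e0 by auto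
      qed
      then have "(d, e, n) \<in> J" using de by (auto simp: J_def)
      moreover have "t \<in> ?R (d, e, n)" using de by (auto simp: dist_commute)
      ultimately show "t \<in> (\<Union>j\<in>J. ?R j)" by blast
    next
      fix t assume "t \<in> (\<Union>j\<in>J. ?R j)"
      then show "t \<in> (\<lambda>t. f t + g t) -` U" by (auto simp: J_def dist_commute)
    qed
    moreover have "?R j \<in> sets borel" for j
      using measurable_sets[OF fm] measurable_sets[OF gm]
      by (auto split: prod.split)
    ultimately show "(\<lambda>t. f t + g t) -` U \<inter> space borel \<in> sets borel"
      using cJ by (auto intro!: sets.countable_UN')
  qed
  ultimately show ?thesis
    using f g by (auto simp: bmeasfun_def intro: bounded_plus_comp)
qed

lemma bmeasfun_uniform_limit:
  fixes f :: "nat \<Rightarrow> 'w::topological_space \<Rightarrow> 'x::metric_space"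
  assumes f: "\<And>n. f n \<in> bmeasfun" and lim: "uniform_limit UNIV f g sequentially"
  shows "g \<in> bmeasfun"
proof -
  have pw: "(\<lambda>n. f n t) \<longlonglongrightarrow> g t" for t
    using tendsto_uniform_limitI[OF lim] by simp
  have "g \<in> borel_measurable borel"
    by (rule borel_measurable_LIMSEQ_metric[where f = f]) (use f pw in \<open>auto simp: bmeasfun_def\<close>)
  moreover have "bounded (range g)"
    using uniform_limit_bounded[OF lim] f by (auto simp: bmeasfun_def)
  moreover have "\<exists>D. countable D \<and> range g \<subseteq> closure D"
  proof -
    have "\<forall>n. \<exists>D. countable D \<and> range (f n) \<subseteq> closure D"
      using f by (auto simp: bmeasfun_def separable_space_subset_closure_iff)
    then obtain D where D: "\<And>n. countable (D n)" "\<And>n. range (f n) \<subseteq> closure (D n)" by metis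
    have "g t \<in> closure (\<Union>n. D n)" for t
    proof (rule Lim_in_closed_set[OF closed_closure _ _ pw])
      have "f n t \<in> closure (\<Union>n. D n)" for n
        using D(2)[of n] closure_mono[of "D n" "\<Union>n. D n"] by auto
      then show "\<forall>\<^sub>F n in sequentially. f n t \<in> closure (\<Union>n. D n)" by simp
    qed auto
    then show ?thesis using D(1) by (intro exI[of _ "\<Union>n. D n"]) auto
  qed
  ultimately show ?thesis by (auto simp: bmeasfun_def separable_space_subset_closure_iff)
qed

instantiation bmeasfun :: (topological_space, real_normed_vector) real_vector
begin

lift_definition plus_bmeasfun :: "('a \<Rightarrow>\<^sub>B 'b) \<Rightarrow> ('a \<Rightarrow>\<^sub>B 'b) \<Rightarrow> 'a \<Rightarrow>\<^sub>B 'b" is "\<lambda>f g t. f t + g t"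
  by (rule bmeasfun_plus)

lift_definition scaleR_bmeasfun :: "real \<Rightarrow> ('a \<Rightarrow>\<^sub>B 'b) \<Rightarrow> 'a \<Rightarrow>\<^sub>B 'b" is "\<lambda>c f t. c *\<^sub>R f t"
  by (rule bmeasfun_scaleR)

lift_definition uminus_bmeasfun :: "('a \<Rightarrow>\<^sub>B 'b) \<Rightarrow> 'a \<Rightarrow>\<^sub>B 'b" is "\<lambda>f t. - f t"
  using bmeasfun_scaleR[where c = "-1"] by auto

lift_definition minus_bmeasfun :: "('a \<Rightarrow>\<^sub>B 'b) \<Rightarrow> ('a \<Rightarrow>\<^sub>B 'b) \<Rightarrow> 'a \<Rightarrow>\<^sub>B 'b" is "\<lambda>f g t. f t - g t"
  using bmeasfun_plus bmeasfun_scaleR[where c = "-1"] by fastforce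

lift_definition zero_bmeasfun :: "'a \<Rightarrow>\<^sub>B 'b" is "\<lambda>_. 0"
  by (rule const_bmeasfun)

instance
  by standard (auto intro!: bmeasfun_eqI simp: plus_bmeasfun.rep_eq scaleR_bmeasfun.rep_eq
      uminus_bmeasfun.rep_eq minus_bmeasfun.rep_eq zero_bmeasfun.rep_eq algebra_simps)

end

instantiation bmeasfun :: (topological_space, real_normed_vector) real_normed_vector
begin

lift_definition norm_bmeasfun :: "('a \<Rightarrow>\<^sub>B 'b) \<Rightarrow> real" is "\<lambda>f. SUP t. norm (f t)" .

definition dist_bmeasfun :: "('a \<Rightarrow>\<^sub>B 'b) \<Rightarrow> ('a \<Rightarrow>\<^sub>B 'b) \<Rightarrow> real"
  where "dist_bmeasfun f g = norm (f - g)"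

definition sgn_bmeasfun :: "('a \<Rightarrow>\<^sub>B 'b) \<Rightarrow> 'a \<Rightarrow>\<^sub>B 'b"
  where "sgn_bmeasfun f = f /\<^sub>R norm f"

definition uniformity_bmeasfun :: "(('a \<Rightarrow>\<^sub>B 'b) \<times> ('a \<Rightarrow>\<^sub>B 'b)) filter"
  where "uniformity_bmeasfun = (INF e\<in>{0 <..}. principal {(x, y). dist x y < e})"

definition open_bmeasfun :: "('a \<Rightarrow>\<^sub>B 'b) set \<Rightarrow> bool"
  where "open_bmeasfun S = (\<forall>x\<in>S. \<forall>\<^sub>F (x', y) in uniformity. x' = x \<longrightarrow> y \<in> S)"

lemma norm_bmeasfun_upper: "norm (apply_bmeasfun f t) \<le> norm (f :: 'a \<Rightarrow>\<^sub>B 'b)"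
  by transfer
    (auto simp: bmeasfun_def bounded_norm_comp intro!: cSUP_upper bounded_imp_bdd_above)

lemma norm_bmeasfun_least:
  "(\<And>t. norm (apply_bmeasfun f t) \<le> b) \<Longrightarrow> norm (f :: 'a \<Rightarrow>\<^sub>B 'b) \<le> b"
  by transfer (auto intro!: cSUP_least)

instance
proof
  fix a :: real and f g :: "'a \<Rightarrow>\<^sub>B 'b"
  show "norm f = 0 \<longleftrightarrow> f = 0"
  proof
    assume "norm f = 0"
    then have "apply_bmeasfun f t = 0" for t using norm_bmeasfun_upper[of f t] by simp
    then show "f = 0" by (intro bmeasfun_eqI) (simp add: zero_bmeasfun.rep_eq)
  qed (simp add: norm_bmeasfun.rep_eq zero_bmeasfun.rep_eq)
  show "norm (f + g) \<le> norm f + norm g"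
    by (rule norm_bmeasfun_least)
      (auto simp: plus_bmeasfun.rep_eq intro!: norm_triangle_le add_mono norm_bmeasfun_upper)
  have le: "norm (a *\<^sub>R f) \<le> \<bar>a\<bar> * norm f" for a :: real and f :: "'a \<Rightarrow>\<^sub>B 'b"
    by (rule norm_bmeasfun_least)
      (auto simp: scaleR_bmeasfun.rep_eq intro!: mult_left_mono norm_bmeasfun_upper)
  have norm_ge: "0 \<le> norm f" for f :: "'a \<Rightarrow>\<^sub>B 'b"
    using norm_bmeasfun_upper[of f undefined] norm_ge_zero[of "apply_bmeasfun f undefined"] by linarith
  show "norm (a *\<^sub>R f) = \<bar>a\<bar> * norm f"
  proof (cases "a = 0")
    case True
    then show ?thesis using le[of a f] norm_ge[of "a *\<^sub>R f"] by simp
  next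
    case False
    then have "norm f \<le> \<bar>inverse a\<bar> * norm (a *\<^sub>R f)" using le[of "inverse a" "a *\<^sub>R f"] by simp
    then have "\<bar>a\<bar> * norm f \<le> norm (a *\<^sub>R f)" using False by (simp add: field_simps)
    with le[of a f] show ?thesis by simp
  qed
qed (rule dist_bmeasfun_def sgn_bmeasfun_def uniformity_bmeasfun_def open_bmeasfun_def)+

end

instance bmeasfun :: (topological_space, banach) banach
proof
  fix f :: "nat \<Rightarrow> 'a \<Rightarrow>\<^sub>B 'b"
  assume C: "Cauchy f"
  have le: "dist (apply_bmeasfun u t) (apply_bmeasfun v t) \<le> dist u v" for u v :: "'a \<Rightarrow>\<^sub>B 'b" and t
    using norm_bmeasfun_upper[of "u - v" t] by (simp add: dist_norm minus_bmeasfun.rep_eq)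
  obtain g where g: "uniform_limit UNIV (\<lambda>n. apply_bmeasfun (f n)) g sequentially"
    using uniformly_convergent_eq_cauchy[of "\<lambda>_. True" "\<lambda>n. apply_bmeasfun (f n)"] C
    unfolding Cauchy_def uniform_limit_sequentially_iff
    by (metis le order_le_less_trans)
  have "g \<in> bmeasfun"
    by (rule bmeasfun_uniform_limit[OF _ g]) (rule apply_bmeasfun)
  then obtain l where l: "g = apply_bmeasfun l" by (metis Bmeasfun_inverse)
  have "f \<longlonglongrightarrow> l"
  proof (rule LIMSEQ_I)
    fix r :: real assume "r > 0"
    then have "r / 2 > 0" by simp
    from uniform_limitD[OF g this] obtain N where
      N: "\<And>n t. n \<ge> N \<Longrightarrow> dist (apply_bmeasfun (f n) t) (g t) < r / 2"
      by (auto simp: eventually_sequentially)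
    have "norm (f n - l) \<le> r / 2" if "n \<ge> N" for n
      by (rule norm_bmeasfun_least)
        (use N[OF that] l in \<open>auto simp: minus_bmeasfun.rep_eq dist_norm intro: less_imp_le\<close>)
    then have "norm (f n - l) < r" if "n \<ge> N" for n
      using that \<open>r > 0\<close> by (smt (verit) field_sum_of_halves)
    then show "\<exists>N. \<forall>n\<ge>N. norm (f n - l) < r" by blast
  qed
  then show "convergent f" by (rule convergentI)
qed


section \<open>Vector measures on the Borel sets\<close>

text \<open>A vector measure is a function on all sets, of which only the values on Borel sets matter.\<close>

definition Borel_partitions :: "'w::topological_space set \<Rightarrow> 'w set set set" where
  "Borel_partitions A = {P. finite P \<and> partition_on A P \<and> P \<subseteq> sets borel}"

definition variation :: "('w::topological_space set \<Rightarrow> 'e::real_normed_vector) \<Rightarrow> 'w set \<Rightarrow> ennreal" where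
  "variation \<nu> A = (SUP P\<in>Borel_partitions A. ennreal (\<Sum>B\<in>P. norm (\<nu> B)))"

definition variation_measure ::
    "('w::topological_space set \<Rightarrow> 'e::real_normed_vector) \<Rightarrow> 'w measure" where
  "variation_measure \<nu> = measure_of UNIV (sets borel) (variation \<nu>)"

definition regular_bv_measure :: "('w::topological_space set \<Rightarrow> 'e::real_normed_vector) \<Rightarrow> bool" where
  "regular_bv_measure \<nu> \<longleftrightarrow>
     (\<forall>A :: nat \<Rightarrow> 'w set. range A \<subseteq> sets borel \<and> disjoint_family A \<longrightarrow>
        (\<lambda>n. \<nu> (A n)) sums \<nu> (\<Union>n. A n)) \<and>
     variation \<nu> UNIV < \<infinity> \<and>
     (\<forall>A\<in>sets borel. \<forall>\<epsilon>>0. \<exists>K U. compact K \<and> open U \<and> K \<subseteq> A \<and> A \<subseteq> U \<and> variation \<nu> (U - K) < \<epsilon>)"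

text \<open>
  \<open>measure_of\<close> returns the zero measure for a set function that is not a measure; by the following
  lemma this does not happen here.
\<close>

lemma regular_bv_measure_empty:
  assumes "regular_bv_measure \<nu>"
  shows "\<nu> {} = 0"
proof -
  have "(\<lambda>n::nat. \<nu> {}) sums \<nu> (\<Union>n::nat. {})"
    using assms unfolding regular_bv_measure_def
    by (elim conjE allE[of _ "\<lambda>_. {}"]) (auto simp: disjoint_family_on_def)
  then have "summable (\<lambda>n::nat. \<nu> {})" by (rule sums_summable)
  then show ?thesis by (simp add: summable_const_iff)
qed

lemma variation_superadditive:
  assumes "A \<in> sets borel" "B \<in> sets borel" "A \<inter> B = {}"
  shows "variation \<nu> A + variation \<nu> B \<le> variation \<nu> (A \<union> B)"
proof -
  have ne: "Borel_partitions C \<noteq> {}" if "C \<in> sets borel" for C :: "'a set"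
  proof -
    have "{C} - {{}} \<in> Borel_partitions C"
      using that by (auto simp: Borel_partitions_def partition_on_def disjoint_def)
    then show ?thesis by blast
  qed
  have "ennreal (\<Sum>C\<in>P. norm (\<nu> C)) + ennreal (\<Sum>C\<in>Q. norm (\<nu> C)) \<le> variation \<nu> (A \<union> B)"
    if P: "P \<in> Borel_partitions A" and Q: "Q \<in> Borel_partitions B" for P Q
  proof -
    have disj: "C \<inter> D = {}" if "C \<in> P" "D \<in> Q" for C D
      using that P Q assms(3) by (auto simp: Borel_partitions_def partition_on_def)
    have "{} \<notin> P" using P by (auto simp: Borel_partitions_def partition_on_def)
    then have PQ: "P \<inter> Q = {}" using disj by fastforce
    have fin: "finite P" "finite Q" using P Q by (auto simp: Borel_partitions_def)
    have "disjoint (P \<union> Q)"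
      unfolding disjoint_def
    proof (intro ballI impI)
      fix C D assume "C \<in> P \<union> Q" "D \<in> P \<union> Q" "C \<noteq> D"
      moreover have "disjoint P" "disjoint Q"
        using P Q by (auto simp: Borel_partitions_def partition_on_def)
      ultimately show "C \<inter> D = {}"
        unfolding disjoint_def using disj by (metis Int_commute Un_iff)
    qed
    then have PQ': "P \<union> Q \<in> Borel_partitions (A \<union> B)"
      using P Q by (simp add: Borel_partitions_def partition_on_def)
    have "ennreal (\<Sum>C\<in>P. norm (\<nu> C)) + ennreal (\<Sum>C\<in>Q. norm (\<nu> C)) =
        ennreal (\<Sum>C\<in>P \<union> Q. norm (\<nu> C))"
      by (simp only: sum.union_disjoint[OF fin PQ] ennreal_plus sum_nonneg norm_ge_zero)
    also have "\<dots> \<le> variation \<nu> (A \<union> B)"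
      unfolding variation_def by (rule SUP_upper[OF PQ'])
    finally show ?thesis .
  qed
  then show ?thesis
    unfolding variation_def[of \<nu> A] variation_def[of \<nu> B]
    using ne[OF assms(1)] ne[OF assms(2)]
    by (subst ennreal_SUP_add_left[symmetric]) (auto simp: ennreal_SUP_add_right intro!: SUP_least)
qed

lemma measure_space_variation:
  fixes \<nu> :: "'w::topological_space set \<Rightarrow> 'e::real_normed_vector"
  assumes \<nu>: "regular_bv_measure \<nu>"
  shows "measure_space UNIV (sets borel) (variation \<nu>)"
proof -
  have sums: "(\<lambda>n. \<nu> (A n)) sums \<nu> (\<Union>n. A n)"
    if "range A \<subseteq> sets borel" "disjoint_family A" for A :: "nat \<Rightarrow> 'w set"
    using \<nu> that by (simp add: regular_bv_measure_def)
  note e = regular_bv_measure_empty[OF \<nu>]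
  have part: "Borel_partitions ({} :: 'w set) = {{}}"
    by (auto simp: Borel_partitions_def partition_on_empty)
  have "variation \<nu> {} = 0"
    by (simp add: variation_def part)
  moreover have "countably_additive (sets borel) (variation \<nu>)"
  proof (rule countably_additiveI)
    fix A :: "nat \<Rightarrow> 'w set"
    assume A: "range A \<subseteq> sets borel" "disjoint_family A" and U: "(\<Union>i. A i) \<in> sets borel"
    have fin: "(\<Sum>i<n. variation \<nu> (A i)) \<le> variation \<nu> (\<Union>i<n. A i)" for n
    proof (induction n)
      case (Suc n)
      have dA: "(\<Union>i<n. A i) \<inter> A n = {}"
      proof -
        have "A i \<inter> A n = {}" if "i < n" for i
          using disjoint_family_onD[OF A(2), of i n] that by simp
        then show ?thesis by blast
      qed
      have "(\<Sum>i<Suc n. variation \<nu> (A i)) \<le> variation \<nu> (\<Union>i<n. A i) + variation \<nu> (A n)"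
        using add_right_mono[OF Suc, of "variation \<nu> (A n)"] by simp
      also have "\<dots> \<le> variation \<nu> ((\<Union>i<n. A i) \<union> A n)"
        using A(1) dA by (intro variation_superadditive) auto
      also have "(\<Union>i<n. A i) \<union> A n = (\<Union>i<Suc n. A i)"
        by (simp add: lessThan_Suc Un_commute)
      finally show ?case .
    qed simp
    have "(\<Sum>i<n. variation \<nu> (A i)) \<le> variation \<nu> (\<Union>i. A i)" for n
    proof -
      let ?V = "\<Union>i<n. A i"
      have V: "?V \<in> sets borel" using A by auto
      have "variation \<nu> ?V \<le> variation \<nu> ?V + variation \<nu> ((\<Union>i. A i) - ?V)" by simp
      also have "\<dots> \<le> variation \<nu> (?V \<union> ((\<Union>i. A i) - ?V))"
        using U V by (intro variation_superadditive) auto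
      also have "?V \<union> ((\<Union>i. A i) - ?V) = (\<Union>i. A i)" by auto
      finally show ?thesis using fin[of n] by (rule order_trans[rotated])
    qed
    then have "(\<Sum>i. variation \<nu> (A i)) \<le> variation \<nu> (\<Union>i. A i)"
      by (intro suminf_le_const) auto
    moreover have "variation \<nu> (\<Union>i. A i) \<le> (\<Sum>i. variation \<nu> (A i))"
      unfolding variation_def[of \<nu> "\<Union>i. A i"]
    proof (rule SUP_least)
      fix P assume "P \<in> Borel_partitions (\<Union>i. A i)"
      then have P: "finite P" "\<Union>P = (\<Union>i. A i)" "disjoint P" "P \<subseteq> sets borel"
        by (auto simp: Borel_partitions_def partition_on_def)
      have 1: "ennreal (norm (\<nu> B)) \<le> (\<Sum>i. ennreal (norm (\<nu> (B \<inter> A i))))" if "B \<in> P" for B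
      proof (rule LIMSEQ_le_const2)
        have "(\<lambda>i. \<nu> (B \<inter> A i)) sums \<nu> (\<Union>i. B \<inter> A i)"
          using A P that by (intro sums) (auto simp: disjoint_family_on_def)
        also have "(\<Union>i. B \<inter> A i) = B" using P that by auto
        finally show "(\<lambda>n. ennreal (norm (\<Sum>i<n. \<nu> (B \<inter> A i)))) \<longlonglongrightarrow> ennreal (norm (\<nu> B))"
          unfolding sums_def by (intro tendsto_ennrealI tendsto_norm)
        have "ennreal (norm (\<Sum>i<n. \<nu> (B \<inter> A i))) \<le> (\<Sum>i. ennreal (norm (\<nu> (B \<inter> A i))))" for n
        proof -
          have "ennreal (norm (\<Sum>i<n. \<nu> (B \<inter> A i))) \<le> ennreal (\<Sum>i<n. norm (\<nu> (B \<inter> A i)))"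
            by (intro ennreal_leI norm_sum)
          also have "\<dots> = (\<Sum>i<n. ennreal (norm (\<nu> (B \<inter> A i))))" by simp
          also have "\<dots> \<le> (\<Sum>i. ennreal (norm (\<nu> (B \<inter> A i))))" by (intro sum_le_suminf) auto
          finally show ?thesis .
        qed
        then show "\<exists>N. \<forall>n\<ge>N. ennreal (norm (\<Sum>i<n. \<nu> (B \<inter> A i))) \<le> (\<Sum>i. ennreal (norm (\<nu> (B \<inter> A i))))"
          by blast
      qed
      have 2: "(\<Sum>B\<in>P. ennreal (norm (\<nu> (B \<inter> A i)))) \<le> variation \<nu> (A i)" for i
      proof -
        let ?Q = "(\<lambda>B. B \<inter> A i) ` P"
        have dis: "B \<inter> C = {}" if "B \<in> P" "C \<in> P" "B \<noteq> C" for B C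
          using P(3) that by (auto simp: disjoint_def)
        have "?Q - {{}} \<in> Borel_partitions (A i)"
          unfolding Borel_partitions_def partition_on_def
        proof (intro CollectI conjI)
          have "\<Union>(?Q - {{}}) = \<Union>P \<inter> A i" by auto
          then show "\<Union>(?Q - {{}}) = A i" unfolding P(2) by auto
          show "disjoint (?Q - {{}})"
            unfolding disjoint_def
          proof (intro ballI impI)
            fix C D assume "C \<in> ?Q - {{}}" "D \<in> ?Q - {{}}" "C \<noteq> D"
            then obtain B B' where B: "B \<in> P" "B' \<in> P" "C = B \<inter> A i" "D = B' \<inter> A i" by auto
            then have "B \<inter> B' = {}" using \<open>C \<noteq> D\<close> by (intro dis) auto
            then show "C \<inter> D = {}" using B by auto
          qed
          have "B \<inter> A i \<in> sets borel" if "B \<in> P" for B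
            using that P(4) A(1) by (intro sets.Int) auto
          then show "?Q - {{}} \<subseteq> sets borel" by auto
        qed (use P(1) in auto)
        moreover have "(\<Sum>B\<in>P. norm (\<nu> (B \<inter> A i))) = (\<Sum>C\<in>?Q. norm (\<nu> C))"
        proof (subst sum.reindex_nontrivial)
          fix B C assume BC: "B \<in> P" "C \<in> P" "B \<noteq> C" "B \<inter> A i = C \<inter> A i"
          then have "B \<inter> A i = {}" using dis[OF BC(1-3)] by auto
          then show "norm (\<nu> (B \<inter> A i)) = 0" using e by simp
        qed (use P(1) in auto)
        moreover have "(\<Sum>C\<in>?Q. norm (\<nu> C)) = (\<Sum>C\<in>?Q - {{}}. norm (\<nu> C))"
          using P(1) e by (intro sum.mono_neutral_right) auto
        ultimately have "ennreal (\<Sum>B\<in>P. norm (\<nu> (B \<inter> A i))) \<le> variation \<nu> (A i)"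
          unfolding variation_def by (intro SUP_upper2[of "?Q - {{}}"]) simp_all
        then show ?thesis by simp
      qed
      have "ennreal (\<Sum>B\<in>P. norm (\<nu> B)) = (\<Sum>B\<in>P. ennreal (norm (\<nu> B)))" by simp
      also have "\<dots> \<le> (\<Sum>B\<in>P. \<Sum>i. ennreal (norm (\<nu> (B \<inter> A i))))" by (intro sum_mono 1)
      also have "\<dots> = (\<Sum>i. \<Sum>B\<in>P. ennreal (norm (\<nu> (B \<inter> A i))))" by (subst suminf_sum) auto
      also have "\<dots> \<le> (\<Sum>i. variation \<nu> (A i))" by (intro suminf_le 2) auto
      finally show "ennreal (\<Sum>B\<in>P. norm (\<nu> B)) \<le> (\<Sum>i. variation \<nu> (A i))" .
    qed
    ultimately show "(\<Sum>i. variation \<nu> (A i)) = variation \<nu> (\<Union>i. A i)" by (rule antisym)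
  qed
  moreover have "sigma_algebra UNIV (sets (borel :: 'w measure))"
    using sets.sigma_algebra_axioms[of "borel :: 'w measure"] by simp
  ultimately show ?thesis by (simp add: measure_space_def positive_def)
qed

lemma emeasure_variation_measure:
  assumes "regular_bv_measure \<nu>" "A \<in> sets borel"
  shows "emeasure (variation_measure \<nu>) A = variation \<nu> A"
  unfolding variation_measure_def
  using measure_space_variation[OF assms(1)] assms(2)
  by (intro emeasure_measure_of_sigma) (auto simp: measure_space_def)

text \<open>
  Integration of \<open>f : \<Omega> \<rightarrow> X\<close> against an \<open>X*\<close>-valued measure: approximation by simple functions in
  the \<open>L\<^sub>1\<close>-seminorm of the variation, as for the Bochner integral.
\<close>

definition simple_dual_integral ::
    "('w::topological_space set \<Rightarrow> 'x::real_normed_vector \<Rightarrow>\<^sub>L real) \<Rightarrow> ('w \<Rightarrow> 'x) \<Rightarrow> real" where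
  "simple_dual_integral \<nu> s = (\<Sum>x\<in>range s. blinfun_apply (\<nu> (s -` {x})) x)"

definition has_dual_integral ::
    "('w::topological_space set \<Rightarrow> 'x::real_normed_vector \<Rightarrow>\<^sub>L real) \<Rightarrow> ('w \<Rightarrow> 'x) \<Rightarrow> real \<Rightarrow> bool" where
  "has_dual_integral \<nu> f I \<longleftrightarrow>
     (\<exists>s. (\<forall>n. simple_function borel (s n)) \<and>
        (\<lambda>n. \<integral>\<^sup>+ t. ennreal (norm (f t - s n t)) \<partial>variation_measure \<nu>) \<longlonglongrightarrow> 0 \<and>
        (\<lambda>n. simple_dual_integral \<nu> (s n)) \<longlonglongrightarrow> I)"


section \<open>Operator-valued measures and the extension to bounded Borel functions\<close>

definition bidual_embedding :: "'a::real_normed_vector \<Rightarrow> ('a \<Rightarrow>\<^sub>L real) \<Rightarrow>\<^sub>L real" where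
  "bidual_embedding a = Blinfun (\<lambda>\<phi>. blinfun_apply \<phi> a)"

lemma bidual_embedding_apply [simp]: "blinfun_apply (bidual_embedding a) \<phi> = blinfun_apply \<phi> a"
  unfolding bidual_embedding_def
  by (subst bounded_linear_Blinfun_apply) (auto intro: bounded_linear_intros)

definition semivariation ::
    "('w::topological_space set \<Rightarrow> 'x::real_normed_vector \<Rightarrow>\<^sub>L 'z::real_normed_vector) \<Rightarrow> 'w set \<Rightarrow> ennreal" where
  "semivariation m A =
     (SUP (P, x) \<in> {(P, x). P \<in> Borel_partitions A \<and> (\<forall>B\<in>P. norm (x B) \<le> 1)}.
        ennreal (norm (\<Sum>B\<in>P. blinfun_apply (m B) (x B))))"

definition strongly_bounded_measure ::
    "('w::topological_space set \<Rightarrow> 'x::real_normed_vector \<Rightarrow>\<^sub>L 'z::real_normed_vector) \<Rightarrow> bool" where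
  "strongly_bounded_measure m \<longleftrightarrow>
     (\<forall>A :: nat \<Rightarrow> 'w set. range A \<subseteq> sets borel \<and> disjoint_family A \<longrightarrow>
        (\<lambda>n. semivariation m (A n)) \<longlonglongrightarrow> 0)"

text \<open>The \<open>X*\<close>-valued measure \<open>A \<mapsto> (x \<mapsto> (m(A) x) (y*))\<close> induced by \<open>y*\<close> in \<open>Y*\<close>.\<close>

definition functional_measure ::
    "('w set \<Rightarrow> 'x::real_normed_vector \<Rightarrow>\<^sub>L ('y::real_normed_vector \<Rightarrow>\<^sub>L real) \<Rightarrow>\<^sub>L real) \<Rightarrow>
     ('y \<Rightarrow>\<^sub>L real) \<Rightarrow> 'w set \<Rightarrow> 'x \<Rightarrow>\<^sub>L real" where
  "functional_measure m \<psi> A = bidual_embedding \<psi> o\<^sub>L m A"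

lemma functional_measure_apply:
  "blinfun_apply (functional_measure m \<psi> A) x = blinfun_apply (blinfun_apply (m A) x) \<psi>"
  by (simp add: functional_measure_def)

text \<open>
  \<open>\<integral> f dm\<close> is the element of \<open>Y**\<close> sending \<open>y*\<close> to the integral of \<open>f\<close> against the measure induced
  by \<open>y*\<close>. If \<open>m\<close> represents \<open>T\<close>, that measure represents \<open>y* \<circ> T\<close> in \<open>C(\<Omega>, X)*\<close>; so this is the
  value of \<open>T**\<close> at \<open>f\<close>, where \<open>f\<close> is regarded as an element of \<open>C(\<Omega>, X)**\<close> via integration.
\<close>

definition has_operator_integral ::
    "('w::topological_space set \<Rightarrow> 'x::real_normed_vector \<Rightarrow>\<^sub>L ('y::real_normed_vector \<Rightarrow>\<^sub>L real) \<Rightarrow>\<^sub>L real) \<Rightarrow>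
     ('w \<Rightarrow> 'x) \<Rightarrow> (('y \<Rightarrow>\<^sub>L real) \<Rightarrow>\<^sub>L real) \<Rightarrow> bool" where
  "has_operator_integral m f F \<longleftrightarrow>
     (\<forall>\<psi>. has_dual_integral (functional_measure m \<psi>) f (blinfun_apply F \<psi>))"

definition representing_measure ::
    "(('w::topological_space \<Rightarrow>\<^sub>C 'x::banach) \<Rightarrow>\<^sub>L 'y::banach) \<Rightarrow>
     ('w set \<Rightarrow> 'x \<Rightarrow>\<^sub>L ('y \<Rightarrow>\<^sub>L real) \<Rightarrow>\<^sub>L real) \<Rightarrow> bool" where
  "representing_measure T m \<longleftrightarrow>
     (\<forall>\<psi>. regular_bv_measure (functional_measure m \<psi>)) \<and>
     semivariation m UNIV < \<infinity> \<and>
     (\<forall>f. has_operator_integral m (apply_bcontfun f) (bidual_embedding (blinfun_apply T f)))"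

text \<open>\<open>T'\<close> is the extension of the operator represented by \<open>m\<close>: \<open>T' f = \<integral> f dm\<close>, as elements of \<open>Y**\<close>.\<close>

definition bounded_Borel_extension ::
    "('w::topological_space set \<Rightarrow> 'x::banach \<Rightarrow>\<^sub>L ('y::banach \<Rightarrow>\<^sub>L real) \<Rightarrow>\<^sub>L real) \<Rightarrow>
     (('w \<Rightarrow>\<^sub>B 'x) \<Rightarrow>\<^sub>L 'y) \<Rightarrow> bool" where
  "bounded_Borel_extension m T' \<longleftrightarrow>
     (\<forall>f. has_operator_integral m (apply_bmeasfun f) (bidual_embedding (blinfun_apply T' f)))"

end

theory Submission
  imports Defs
begin

text \<open>
  One implication is easy: \<open>C(\<Omega>, X)\<close> embeds isometrically in \<open>B(\<Omega>, X)\<close>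
  by a map \<open>J\<close>, and \<open>That \<circ> J = T\<close>. Images under \<open>J\<close> of weakly
  \<open>p\<close>-summable sequences and of Dunford-Pettis sets are again of this kind, since
  \<open>J\<close> has an adjoint.

  For the other implication let \<open>x\<^sub>n\<close> be a weakly \<open>p\<close>-summable sequence in
  \<open>B(\<Omega>, X)\<close> that forms a Dunford-Pettis set, and let \<open>\<epsilon> > 0\<close>. The
  point is to find continuous \<open>h\<^sub>n\<close> with \<open>\<parallel>h\<^sub>n\<parallel> \<le>
  \<parallel>x\<^sub>n\<parallel>\<close> that agree with all \<open>x\<^sub>n\<close> on one compact set
  \<open>K\<close> whose complement has variation at most \<open>\<epsilon>\<close> under each measure
  \<open>y* \<circ> m\<close> with \<open>\<parallel>y*\<parallel> \<le> 1\<close>, in such a way that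
  \<open>(h\<^sub>n)\<close> inherits both properties of \<open>(x\<^sub>n)\<close> (lemma
  \<open>continuous_representatives\<close>). Then \<open>T h\<^sub>n\<close> tends to 0 by hypothesis, while
  \<open>T h\<^sub>n - That x\<^sub>n\<close> is an integral over the complement of \<open>K\<close> only, of
  norm at most \<open>2 \<epsilon> sup \<parallel>x\<^sub>n\<parallel>\<close> (lemma
  \<open>norm_extension_diff_le\<close>).

  The set \<open>K\<close> comes from strong boundedness. Every Borel set is approximable from inside by
  compact sets uniformly for all measures \<open>y* \<circ> m\<close> with \<open>\<parallel>y*\<parallel>
  \<le> 1\<close>; otherwise it would contain infinitely many disjoint compact sets of semivariation bounded
  away from 0 (lemma \<open>uniform_inner_regularity\<close>). Apply this to a sequence of Borel sets
  \<open>A\<^sub>j\<close> among which, for every \<open>n\<close> and \<open>\<delta> > 0\<close>, those on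
  which \<open>x\<^sub>n\<close> oscillates by at most \<open>\<delta>\<close> cover \<open>\<Omega>\<close>,
  and to the complements of the \<open>A\<^sub>j\<close>. This gives \<open>K\<close> such that all
  \<open>A\<^sub>j \<inter> K\<close> are clopen in \<open>K\<close>, so that on \<open>K\<close> each
  \<open>x\<^sub>n\<close> depends continuously on the 0-1-sequence that codes membership in the
  \<open>A\<^sub>j\<close>, and Urysohn's lemma extends the indicator of \<open>A\<^sub>j \<inter> K\<close>
  to a continuous \<open>g\<^sub>j : \<Omega> \<rightarrow> [0, 1]\<close>. The values
  \<open>g\<^sub>j(t)\<close> are read as the probabilities of independent bits: \<open>h\<^sub>n(t)\<close>
  is the expected value of \<open>x\<^sub>n\<close> at a point of \<open>K\<close> with a random code.
  Stopping after \<open>N\<close> bits gives contractions \<open>S\<^sub>N : B(\<Omega>, X) \<rightarrow>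
  C(\<Omega>, X)\<close> with \<open>S\<^sub>N x\<^sub>n \<longlonglongrightarrow> h\<^sub>n\<close> in norm
  (lemma \<open>continuous_extension_operators\<close>).

  The map \<open>x\<^sub>n \<mapsto> h\<^sub>n\<close> itself is only defined on a subspace of
  \<open>B(\<Omega>, X)\<close>, and a Dunford-Pettis set need not be a Dunford-Pettis set in a subspace that
  contains it. But the \<open>S\<^sub>N\<close> are defined everywhere, so a cluster point of \<open>\<Phi>
  \<mapsto> \<Phi> \<circ> S\<^sub>N\<close> is a bounded linear map \<open>E : C(\<Omega>, X)* \<rightarrow>
  B(\<Omega>, X)*\<close> with \<open>E(\<Phi>)(x\<^sub>n) = \<Phi>(h\<^sub>n)\<close> (lemma
  \<open>dual_lifting_of_approximating_operators\<close>). Such an \<open>E\<close> carries both properties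
  over.
\<close>


section \<open>Norming functionals\<close>

text \<open>
  Homogeneity is asked for as an inequality and for positive factors only; equality and the
  value at 0 follow. In this form the conditions pass to pointwise infima directly.
\<close>

definition sublinear_minorant :: "('a::real_normed_vector \<Rightarrow> real) \<Rightarrow> bool" where
  "sublinear_minorant p \<longleftrightarrow>
     (\<forall>x y. p (x + y) \<le> p x + p y) \<and> (\<forall>c>0. \<forall>x. p (c *\<^sub>R x) \<le> c * p x) \<and> (\<forall>x. p x \<le> norm x)"

lemma sublinear_minorantD:
  assumes "sublinear_minorant p"
  shows sublinear_minorant_add: "p (x + y) \<le> p x + p y"
    and sublinear_minorant_scaleR: "c > 0 \<Longrightarrow> p (c *\<^sub>R x) = c * p x"
    and sublinear_minorant_le_norm: "p x \<le> norm x"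
    and sublinear_minorant_ge: "- norm x \<le> p x"
    and sublinear_minorant_zero: "p 0 = 0"
proof -
  have add: "p (x + y) \<le> p x + p y" and le: "p x \<le> norm x"
    and sc: "c > 0 \<Longrightarrow> p (c *\<^sub>R x) \<le> c * p x" for c x y
    using assms by (auto simp: sublinear_minorant_def)
  show "p (x + y) \<le> p x + p y" "p x \<le> norm x" by (rule add le)+
  show z: "p 0 = 0" using le[of 0] add[of 0 0] by simp
  show "- norm x \<le> p x" using add[of x "- x"] le[of "- x"] z by simp
  show "p (c *\<^sub>R x) = c * p x" if "c > 0"
    using sc[OF that, of x] sc[of "inverse c" "c *\<^sub>R x"] that by (simp add: field_simps)
qed

text \<open>
  The functional \<open>q x = inf {p (x + t a) - t p a | t \<ge> 0}\<close>. It serves twice in the proof of the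
  Hahn-Banach theorem: to start from a functional with prescribed value at one point, and to show
  that a minimal sublinear functional, which must equal its \<open>q\<close>, is additive.
\<close>

lemma sublinear_minorant_shift:
  fixes p :: "'a::real_normed_vector \<Rightarrow> real"
  assumes p: "sublinear_minorant p"
  obtains q where "sublinear_minorant q" "\<And>x. q x \<le> p x" "\<And>x. q x \<le> p (x + a) - p a"
proof -
  note P = sublinear_minorantD[OF p]
  define V where "V x = (\<lambda>t. p (x + t *\<^sub>R a) - t * p a) ` {0..}" for x
  define q where "q x = Inf (V x)" for x
  have ta: "p (t *\<^sub>R a) = t * p a" if "t \<ge> 0" for t
    using that P(2)[of t a] P(5) by (cases "t = 0") auto
  have bdd: "bdd_below (V x)" for x
  proof (rule bdd_belowI)
    fix r assume "r \<in> V x"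
    then obtain t where t: "t \<ge> 0" "r = p (x + t *\<^sub>R a) - t * p a" by (auto simp: V_def)
    show "- norm x \<le> r"
      using P(1)[of "x + t *\<^sub>R a" "- x"] P(3)[of "- x"] t ta[of t] by (simp add: algebra_simps)
  qed
  have ne: "V x \<noteq> {}" for x by (auto simp: V_def)
  have q_le: "q x \<le> p (x + t *\<^sub>R a) - t * p a" if "t \<ge> 0" for x t
    unfolding q_def using that by (intro cInf_lower bdd) (auto simp: V_def)
  have q_p: "q x \<le> p x" for x using q_le[of 0 x] by simp
  have "q (x + y) \<le> q x + q y" for x y
  proof -
    have 1: "q (x + y) \<le> u + v" if uv: "u \<in> V x" "v \<in> V y" for u v
    proof -
      obtain s where s: "s \<ge> 0" "u = p (x + s *\<^sub>R a) - s * p a"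
        using uv(1) by (auto simp: V_def)
      obtain t where t: "t \<ge> 0" "v = p (y + t *\<^sub>R a) - t * p a"
        using uv(2) by (auto simp: V_def)
      show ?thesis
        using q_le[of "s + t" "x + y"] P(1)[of "x + s *\<^sub>R a" "y + t *\<^sub>R a"] s t
        by (simp add: algebra_simps)
    qed
    have "q (x + y) - v \<le> q x" if "v \<in> V y" for v
      unfolding q_def[of x] using 1[OF _ that] by (intro cInf_greatest ne) (simp add: algebra_simps)
    then have "q (x + y) - q x \<le> q y"
      unfolding q_def[of y] by (intro cInf_greatest ne) (simp add: algebra_simps)
    then show ?thesis by simp
  qed
  moreover have "q (c *\<^sub>R x) \<le> c * q x" if c: "c > 0" for c x
  proof -
    have "q (c *\<^sub>R x) / c \<le> u" if u: "u \<in> V x" for u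
    proof -
      obtain t where t: "t \<ge> 0" "u = p (x + t *\<^sub>R a) - t * p a"
        using u by (auto simp: V_def)
      have "q (c *\<^sub>R x) \<le> c * u"
        using q_le[of "c * t" "c *\<^sub>R x"] P(2)[OF c, of "x + t *\<^sub>R a"] t(1) c
        unfolding t(2) by (simp add: algebra_simps)
      then show ?thesis using c by (simp add: field_simps)
    qed
    then have "q (c *\<^sub>R x) / c \<le> q x"
      unfolding q_def[of x] by (intro cInf_greatest ne)
    then show ?thesis using c by (simp add: field_simps)
  qed
  moreover have "q x \<le> norm x" for x using q_p[of x] P(3)[of x] by linarith
  ultimately have "sublinear_minorant q" by (auto simp: sublinear_minorant_def)
  then show ?thesis using q_p q_le[of 1] by (intro that[of q]) auto
qed

text \<open>
  By Zorn's lemma: the pointwise infimum of a chain of sublinear functionals below the norm is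
  finite, because such functionals are at least \<open>- norm x\<close>, and it is subadditive, because of two
  members of the chain one is below the other.
\<close>

lemma minimal_sublinear_minorant:
  fixes p0 :: "'a::real_normed_vector \<Rightarrow> real"
  assumes "sublinear_minorant p0"
  obtains p where "sublinear_minorant p" "p \<le> p0" "\<And>q. sublinear_minorant q \<Longrightarrow> q \<le> p \<Longrightarrow> q = p"
proof -
  define A where "A = {p :: 'a \<Rightarrow> real. sublinear_minorant p \<and> p \<le> p0}"
  have "\<exists>m\<in>A. \<forall>a\<in>A. m \<ge> a \<longrightarrow> a = m"
  proof (rule predicate_Zorn)
    show "partial_order_on A (relation_of (\<ge>) A)"
      by (auto simp: partial_order_on_def preorder_on_def refl_on_def trans_def antisym_def relation_of_def)
  next
    fix C assume C: "C \<in> Chains (relation_of (\<ge>) A)"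
    show "\<exists>u\<in>A. \<forall>a\<in>C. u \<le> a"
    proof (cases "C = {}")
      case True
      then show ?thesis using assms by (auto simp: A_def)
    next
      case ne: False
      have CA: "sublinear_minorant p" "p \<le> p0" if "p \<in> C" for p
        using C that by (auto simp: Chains_def relation_of_def A_def)
      have tot: "p \<le> q \<or> q \<le> p" if "p \<in> C" "q \<in> C" for p q
        using C that by (auto simp: Chains_def relation_of_def)
      define u where "u x = (INF p\<in>C. p x)" for x
      have le: "u x \<le> p x" if "p \<in> C" for p x
        unfolding u_def using that CA
        by (intro cINF_lower bdd_belowI2[of _ "- norm x"] sublinear_minorant_ge) auto
      have ge: "r \<le> u x" if "\<And>p. p \<in> C \<Longrightarrow> r \<le> p x" for r x
        unfolding u_def using ne that by (rule cINF_greatest)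
      have add: "u (x + y) \<le> u x + u y" for x y
      proof -
        have 1: "u (x + y) \<le> p x + q y" if pq: "p \<in> C" "q \<in> C" for p q
        proof -
          obtain r where r: "r \<in> C" "r \<le> p" "r \<le> q" using tot[OF pq] pq by auto
          show ?thesis
            using le[OF r(1), of "x + y"] sublinear_minorant_add[OF CA(1)[OF r(1)], of x y]
              le_funD[OF r(2), of x] le_funD[OF r(3), of y] by linarith
        qed
        have "u (x + y) - q y \<le> u x" if "q \<in> C" for q
          by (rule ge) (use 1[OF _ that] in \<open>simp add: algebra_simps\<close>)
        then have "u (x + y) - u x \<le> u y"
          by (intro ge) (simp add: algebra_simps)
        then show ?thesis by simp
      qed
      have scale: "u (c *\<^sub>R x) \<le> c * u x" if "c > 0" for c x
      proof -
        have "u (c *\<^sub>R x) / c \<le> u x"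
        proof (rule ge)
          fix p assume "p \<in> C"
          then show "u (c *\<^sub>R x) / c \<le> p x"
            using le[of p "c *\<^sub>R x"] sublinear_minorant_scaleR[OF CA(1), of p c x] that
            by (simp add: field_simps)
        qed
        then show ?thesis using that by (simp add: field_simps)
      qed
      obtain p where p: "p \<in> C" using ne by auto
      have "u x \<le> norm x" for x
        using le[OF p, of x] sublinear_minorant_le_norm[OF CA(1)[OF p], of x] by linarith
      then have "sublinear_minorant u" using add scale by (auto simp: sublinear_minorant_def)
      moreover have "u \<le> p0"
        using le[OF p] CA(2)[OF p] by (intro le_funI) (meson le_funD order_trans)
      ultimately show ?thesis using le by (auto simp: A_def le_fun_def)
    qed
  qed
  then obtain p where p: "p \<in> A" and min: "\<And>q. q \<in> A \<Longrightarrow> q \<le> p \<Longrightarrow> q = p" by blast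
  show ?thesis
  proof (rule that)
    show "sublinear_minorant p" "p \<le> p0" using p by (auto simp: A_def)
    show "q = p" if "sublinear_minorant q" "q \<le> p" for q
      by (rule min) (use p that in \<open>auto simp: A_def intro: order_trans\<close>)
  qed
qed

text \<open>
  A minimal sublinear functional below \<open>x \<mapsto> \<parallel>x + y\<parallel> - \<parallel>y\<parallel>\<close> is linear and takes a value of
  at most \<open>- \<parallel>y\<parallel>\<close> at \<open>- y\<close>.
\<close>

lemma Hahn_Banach_norming_functional:
  fixes y :: "'a::real_normed_vector"
  obtains \<psi> :: "'a \<Rightarrow>\<^sub>L real" where "norm \<psi> \<le> 1" "blinfun_apply \<psi> y = norm y"
proof -
  have "sublinear_minorant (norm :: 'a \<Rightarrow> real)"
    by (auto simp: sublinear_minorant_def norm_triangle_ineq)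
  then obtain q where q: "sublinear_minorant q" "\<And>x. q x \<le> norm (x + y) - norm y"
    using sublinear_minorant_shift[of norm y] by metis
  obtain p where p: "sublinear_minorant p" "p \<le> q"
    and min: "\<And>r. sublinear_minorant r \<Longrightarrow> r \<le> p \<Longrightarrow> r = p"
    using minimal_sublinear_minorant[OF q(1)] by metis
  note P = sublinear_minorantD[OF p(1)]
  have add: "p (x + a) = p x + p a" for x a
  proof -
    obtain r where r: "sublinear_minorant r" "\<And>x. r x \<le> p x" "\<And>x. r x \<le> p (x + a) - p a"
      using sublinear_minorant_shift[OF p(1), of a] by metis
    have "r = p" by (rule min) (use r in \<open>auto simp: le_fun_def\<close>)
    then show ?thesis using r(3)[of x] P(1)[of x a] by simp
  qed
  have neg: "p (- x) = - p x" for x using add[of x "- x"] P(5) by simp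
  have scale: "p (c *\<^sub>R x) = c * p x" for c x
  proof (cases c "0 :: real" rule: linorder_cases)
    case less
    then show ?thesis using P(2)[of "- c" x] neg[of "c *\<^sub>R x"] by simp
  qed (use P in auto)
  have bound: "\<bar>p x\<bar> \<le> norm x" for x using P(3)[of x] P(4)[of x] by auto
  have lin: "bounded_linear p"
    by (rule bounded_linear_intro[where K = 1]) (use add scale bound in auto)
  show ?thesis
  proof (rule that)
    show "norm (Blinfun p) \<le> 1"
      by (rule norm_blinfun_bound) (use bound in \<open>auto simp: bounded_linear_Blinfun_apply[OF lin]\<close>)
    have "p (- y) \<le> - norm y" using q(2)[of "- y"] le_funD[OF p(2), of "- y"] by simp
    then show "blinfun_apply (Blinfun p) y = norm y"
      using neg[of y] P(3)[of y] by (simp add: bounded_linear_Blinfun_apply[OF lin])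
  qed
qed

lemma norm_le_if_functionals_le:
  fixes y :: "'a::real_normed_vector"
  assumes "\<And>\<psi> :: 'a \<Rightarrow>\<^sub>L real. norm \<psi> \<le> 1 \<Longrightarrow> \<bar>blinfun_apply \<psi> y\<bar> \<le> c"
  shows "norm y \<le> c"
  using Hahn_Banach_norming_functional[of y] assms by (metis abs_norm_cancel)


section \<open>Estimates for the dual integral\<close>

lemma simple_function_bmeasfun:
  fixes s :: "'w::topological_space \<Rightarrow> 'x::metric_space"
  assumes "simple_function borel s"
  shows "s \<in> bmeasfun"
proof -
  have fin: "finite (range s)" using assms by (simp add: simple_function_def)
  then have "separable_space (top_of_set (range s))"
    unfolding separable_space_subset_closure_iff
    by (intro exI[of _ "range s"]) (auto simp: countable_finite closure_subset)
  then show ?thesis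
    using fin borel_measurable_simple_function[OF assms]
    by (auto simp: bmeasfun_def finite_imp_bounded)
qed

lemma bmeasfun_diff:
  fixes f g :: "'w::topological_space \<Rightarrow> 'x::real_normed_vector"
  assumes "f \<in> bmeasfun" "g \<in> bmeasfun"
  shows "(\<lambda>t. f t - g t) \<in> bmeasfun"
  using bmeasfun_plus[OF assms(1) bmeasfun_scaleR[OF assms(2), of "-1"]] by simp

lemma sets_variation_measure [simp, measurable_cong]: "sets (variation_measure \<nu>) = sets borel"
  unfolding variation_measure_def using sets.sigma_sets_eq[of borel] by (simp add: sets_measure_of_conv)

lemma finitely_additive_regular_bv_measure:
  assumes \<nu>: "regular_bv_measure \<nu>" and fin: "finite I"
    and A: "\<And>i. i \<in> I \<Longrightarrow> A i \<in> sets borel" and dis: "disjoint_family_on A I"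
  shows "\<nu> (\<Union>i\<in>I. A i) = (\<Sum>i\<in>I. \<nu> (A i))"
proof -
  note e = regular_bv_measure_empty[OF \<nu>]
  have two: "\<nu> (B \<union> C) = \<nu> B + \<nu> C" if BC: "B \<in> sets borel" "C \<in> sets borel" "B \<inter> C = {}" for B C
  proof -
    have "(\<lambda>n. \<nu> (binaryset B C n)) sums \<nu> (\<Union>n. binaryset B C n)"
    proof -
      have "range (binaryset B C) \<subseteq> sets borel \<and> disjoint_family (binaryset B C)"
        using BC by (auto simp: range_binaryset_eq disjoint_family_on_def binaryset_def)
      then show ?thesis using \<nu> by (simp add: regular_bv_measure_def)
    qed
    moreover have "(\<lambda>n. \<nu> (binaryset B C n)) sums (\<nu> B + \<nu> C)" by (rule binaryset_sums[where f = \<nu>, OF e])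
    ultimately show ?thesis by (auto simp: UN_binaryset_eq dest: sums_unique2)
  qed
  show ?thesis using fin A dis
  proof (induction rule: finite_induct)
    case (insert i I)
    have "\<nu> (A i \<union> (\<Union>j\<in>I. A j)) = \<nu> (A i) + \<nu> (\<Union>j\<in>I. A j)"
      using insert.prems insert.hyps by (intro two) (auto simp: disjoint_family_on_def)
    then show ?case using insert by (simp add: disjoint_family_on_def)
  qed (simp add: e)
qed

text \<open>
  The integral of a simple function may be computed on any finite partition, here the fibres of
  \<open>g\<close>, on which the function is constant. For two simple functions, the fibres of the pair
  are such a partition for both, which gives linearity.
\<close>

lemma simple_dual_integral_partition:
  fixes s :: "'w::topological_space \<Rightarrow> 'x::real_normed_vector"
    and g :: "'w \<Rightarrow> 'b"
  assumes \<nu>: "regular_bv_measure \<nu>" and fin: "finite (range g)"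
    and g: "\<And>b. g -` {b} \<in> sets borel" and s: "\<And>t. s t = h (g t)"
  shows "simple_dual_integral \<nu> s = (\<Sum>b\<in>range g. blinfun_apply (\<nu> (g -` {b})) (h b))"
proof -
  have "simple_dual_integral \<nu> s =
      (\<Sum>x\<in>h ` range g. blinfun_apply (\<nu> (s -` {x})) x)"
    unfolding simple_dual_integral_def by (intro sum.cong) (auto simp: s image_image)
  also have "\<dots> = (\<Sum>x\<in>h ` range g. \<Sum>b\<in>{b \<in> range g. h b = x}. blinfun_apply (\<nu> (g -` {b})) (h b))"
  proof (rule sum.cong[OF refl])
    fix x assume "x \<in> h ` range g"
    have "s -` {x} = (\<Union>b\<in>{b \<in> range g. h b = x}. g -` {b})" by (auto simp: s)
    then have "\<nu> (s -` {x}) = (\<Sum>b\<in>{b \<in> range g. h b = x}. \<nu> (g -` {b}))"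
      using fin g by (simp only:, intro finitely_additive_regular_bv_measure[OF \<nu>])
        (auto simp: disjoint_family_on_def)
    then show "blinfun_apply (\<nu> (s -` {x})) x =
        (\<Sum>b\<in>{b \<in> range g. h b = x}. blinfun_apply (\<nu> (g -` {b})) (h b))"
      by (auto simp: blinfun.sum_left intro!: sum.cong)
  qed
  also have "\<dots> = (\<Sum>b\<in>range g. blinfun_apply (\<nu> (g -` {b})) (h b))"
    using fin by (intro sum.image_gen[symmetric])
  finally show ?thesis .
qed

lemma simple_dual_integral_diff:
  fixes s r :: "'w::topological_space \<Rightarrow> 'x::real_normed_vector"
  assumes \<nu>: "regular_bv_measure \<nu>" and s: "simple_function borel s" and r: "simple_function borel r"
  shows "simple_dual_integral \<nu> (\<lambda>t. s t - r t) = simple_dual_integral \<nu> s - simple_dual_integral \<nu> r"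
proof -
  let ?g = "\<lambda>t. (s t, r t)"
  have fin: "finite (range ?g)"
    by (rule finite_subset[of _ "range s \<times> range r"]) (use s r in \<open>auto simp: simple_function_def\<close>)
  have pre: "u -` {x} \<in> sets borel" if "simple_function borel u" for u :: "'w \<Rightarrow> 'x" and x
    using simple_functionD(2)[OF that, of "{x}"] by simp
  have g: "?g -` {b} \<in> sets borel" for b
  proof -
    have "?g -` {b} = s -` {fst b} \<inter> r -` {snd b}" by auto
    then show ?thesis using pre[OF s] pre[OF r] by auto
  qed
  note part = simple_dual_integral_partition[OF \<nu> fin g]
  show ?thesis
    by (subst part[where s = s and h = fst] part[where s = r and h = snd]
          part[where s = "\<lambda>t. s t - r t" and h = "\<lambda>b. fst b - snd b"], simp)+
      (simp add: blinfun.diff_right sum_subtractf)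
qed

lemma simple_dual_integral_le_variation:
  fixes s :: "'w::topological_space \<Rightarrow> 'x::real_normed_vector"
  assumes \<nu>: "regular_bv_measure \<nu>" and s: "simple_function borel s"
  shows "ennreal \<bar>simple_dual_integral \<nu> s\<bar> \<le> (\<integral>\<^sup>+ t. ennreal (norm (s t)) \<partial>variation_measure \<nu>)"
proof -
  have pre: "s -` {x} \<in> sets borel" for x
    using simple_functionD(2)[OF s, of "{x}"] by simp
  have fin: "finite (range s)" using s by (simp add: simple_function_def)
  have le: "ennreal (norm (\<nu> A)) \<le> variation \<nu> A" if "A \<in> sets borel" for A
  proof -
    have "{A} - {{}} \<in> Borel_partitions A"
      using that by (auto simp: Borel_partitions_def partition_on_def disjoint_def)
    then have "ennreal (\<Sum>B\<in>{A} - {{}}. norm (\<nu> B)) \<le> variation \<nu> A"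
      unfolding variation_def by (rule SUP_upper)
    then show ?thesis
      using regular_bv_measure_empty[OF \<nu>] by (cases "A = {}") auto
  qed
  have "\<bar>simple_dual_integral \<nu> s\<bar> \<le> (\<Sum>x\<in>range s. norm (\<nu> (s -` {x})) * norm x)"
    unfolding simple_dual_integral_def
    by (rule order_trans[OF sum_abs]) (intro sum_mono, metis norm_blinfun real_norm_def)
  then have "ennreal \<bar>simple_dual_integral \<nu> s\<bar> \<le> (\<Sum>x\<in>range s. ennreal (norm (\<nu> (s -` {x})) * norm x))"
    by (subst sum_ennreal) (auto intro: ennreal_leI)
  also have "\<dots> = (\<Sum>x\<in>range s. ennreal (norm x) * ennreal (norm (\<nu> (s -` {x}))))"
    by (intro sum.cong) (auto simp: ennreal_mult' mult.commute)
  also have "\<dots> \<le> (\<Sum>x\<in>range s. ennreal (norm x) * emeasure (variation_measure \<nu>) (s -` {x}))"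
    using le[OF pre] emeasure_variation_measure[OF \<nu> pre]
    by (intro sum_mono mult_left_mono) auto
  also have "\<dots> = (\<Sum>x\<in>range s. \<integral>\<^sup>+ t. ennreal (norm x) * indicator (s -` {x}) t \<partial>variation_measure \<nu>)"
    using pre by (intro sum.cong refl nn_integral_cmult_indicator[symmetric]) simp
  also have "\<dots> = (\<integral>\<^sup>+ t. (\<Sum>x\<in>range s. ennreal (norm x) * indicator (s -` {x}) t) \<partial>variation_measure \<nu>)"
    using pre by (intro nn_integral_sum[symmetric]) simp
  also have "(\<lambda>t. \<Sum>x\<in>range s. ennreal (norm x) * indicator (s -` {x}) t) = (\<lambda>t. ennreal (norm (s t)))"
  proof
    fix t
    have "(\<Sum>x\<in>range s. ennreal (norm x) * indicator (s -` {x}) t) =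
        (\<Sum>x\<in>{s t}. ennreal (norm x) * indicator (s -` {x}) t)"
      by (rule sum.mono_neutral_right[OF fin]) (auto simp: indicator_def)
    then show "(\<Sum>x\<in>range s. ennreal (norm x) * indicator (s -` {x}) t) = ennreal (norm (s t))"
      by simp
  qed
  finally show ?thesis .
qed

text \<open>
  The integrals differ by at most the \<open>L\<^sub>1\<close>-seminorm of \<open>f - g\<close>, which vanishes on \<open>K\<close> and is
  bounded by \<open>c\<close>. The integrands are required to have separable range so that their differences
  are measurable.
\<close>

lemma has_dual_integral_diff_le:
  fixes f g :: "'w::topological_space \<Rightarrow> 'x::real_normed_vector"
  assumes \<nu>: "regular_bv_measure \<nu>"
    and f: "f \<in> bmeasfun" and g: "g \<in> bmeasfun"
    and I: "has_dual_integral \<nu> f I" and J: "has_dual_integral \<nu> g J"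
    and K: "K \<in> sets borel" and eq: "\<And>t. t \<in> K \<Longrightarrow> f t = g t"
    and c: "\<And>t. norm (f t - g t) \<le> c"
  shows "ennreal \<bar>I - J\<bar> \<le> ennreal c * variation \<nu> (UNIV - K)"
proof -
  let ?M = "variation_measure \<nu>"
  let ?N = "\<lambda>u :: 'w \<Rightarrow> 'x. \<integral>\<^sup>+ t. ennreal (norm (u t)) \<partial>?M"
  obtain s where s: "\<And>n. simple_function borel (s n)" "(\<lambda>n. ?N (\<lambda>t. f t - s n t)) \<longlonglongrightarrow> 0"
      "(\<lambda>n. simple_dual_integral \<nu> (s n)) \<longlonglongrightarrow> I"
    using I by (auto simp: has_dual_integral_def)
  obtain r where r: "\<And>n. simple_function borel (r n)" "(\<lambda>n. ?N (\<lambda>t. g t - r n t)) \<longlonglongrightarrow> 0"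
      "(\<lambda>n. simple_dual_integral \<nu> (r n)) \<longlonglongrightarrow> J"
    using J by (auto simp: has_dual_integral_def)
  have meas: "(\<lambda>t. ennreal (norm (u t))) \<in> borel_measurable ?M" if "u \<in> bmeasfun" for u :: "'w \<Rightarrow> 'x"
    using that by (auto simp: bmeasfun_def measurable_cong_sets[OF sets_variation_measure refl])
  have bd: "ennreal \<bar>simple_dual_integral \<nu> (s n) - simple_dual_integral \<nu> (r n)\<bar> \<le>
      ?N (\<lambda>t. f t - s n t) + (?N (\<lambda>t. f t - g t) + ?N (\<lambda>t. g t - r n t))" for n
  proof -
    have "simple_function borel (\<lambda>t. s n t - r n t)"
      using simple_function_compose2[OF s(1)[of n] r(1)[of n], of "(-)"] .
    then have "ennreal \<bar>simple_dual_integral \<nu> (s n) - simple_dual_integral \<nu> (r n)\<bar> \<le>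
        ?N (\<lambda>t. s n t - r n t)"
      using simple_dual_integral_le_variation[OF \<nu>] simple_dual_integral_diff[OF \<nu> s(1) r(1)] by metis
    also have "\<dots> \<le> (\<integral>\<^sup>+ t. ennreal (norm (f t - s n t)) +
        (ennreal (norm (f t - g t)) + ennreal (norm (g t - r n t))) \<partial>?M)"
    proof (rule nn_integral_mono)
      fix t
      have "norm (s n t - r n t) \<le> norm (f t - s n t) + (norm (f t - g t) + norm (g t - r n t))"
        by norm
      then show "ennreal (norm (s n t - r n t)) \<le>
          ennreal (norm (f t - s n t)) + (ennreal (norm (f t - g t)) + ennreal (norm (g t - r n t)))"
        by (simp flip: ennreal_plus add: ennreal_leI)
    qed
    also have "\<dots> = ?N (\<lambda>t. f t - s n t) + (?N (\<lambda>t. f t - g t) + ?N (\<lambda>t. g t - r n t))"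
    proof -
      note m = meas[OF bmeasfun_diff[OF f simple_function_bmeasfun[OF s(1)[of n]]]]
        meas[OF bmeasfun_diff[OF f g]]
        meas[OF bmeasfun_diff[OF g simple_function_bmeasfun[OF r(1)[of n]]]]
      show ?thesis
        using nn_integral_add[OF m(1) borel_measurable_add[OF m(2,3)]] nn_integral_add[OF m(2,3)]
        by simp
    qed
    finally show ?thesis .
  qed
  have "ennreal \<bar>I - J\<bar> \<le> 0 + (?N (\<lambda>t. f t - g t) + 0)"
  proof (rule LIMSEQ_le)
    show "(\<lambda>n. ennreal \<bar>simple_dual_integral \<nu> (s n) - simple_dual_integral \<nu> (r n)\<bar>) \<longlonglongrightarrow> ennreal \<bar>I - J\<bar>"
      by (intro tendsto_ennrealI tendsto_rabs tendsto_diff s r)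
    show "(\<lambda>n. ?N (\<lambda>t. f t - s n t) + (?N (\<lambda>t. f t - g t) + ?N (\<lambda>t. g t - r n t)))
        \<longlonglongrightarrow> 0 + (?N (\<lambda>t. f t - g t) + 0)"
      by (intro tendsto_add s r tendsto_const)
  qed (use bd in blast)
  also have "0 + (?N (\<lambda>t. f t - g t) + 0) \<le> (\<integral>\<^sup>+ t. ennreal c * indicator (UNIV - K) t \<partial>?M)"
    using eq c by (auto intro!: nn_integral_mono ennreal_leI simp: indicator_def)
  also have "\<dots> = ennreal c * variation \<nu> (UNIV - K)"
    using K by (subst nn_integral_cmult_indicator) (auto simp: emeasure_variation_measure[OF \<nu>])
  finally show ?thesis .
qed


section \<open>Uniform inner regularity\<close>

lemma variation_mono:
  assumes "regular_bv_measure \<nu>" "A \<in> sets borel" "B \<in> sets borel" "A \<subseteq> B"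
  shows "variation \<nu> A \<le> variation \<nu> B"
  using emeasure_mono[of A B "variation_measure \<nu>"] assms
  by (simp add: emeasure_variation_measure sets_variation_measure)

lemma variation_Un_le:
  assumes "regular_bv_measure \<nu>" "A \<in> sets borel" "B \<in> sets borel"
  shows "variation \<nu> (A \<union> B) \<le> variation \<nu> A + variation \<nu> B"
  using emeasure_subadditive[of A "variation_measure \<nu>" B] assms
  by (simp add: emeasure_variation_measure sets_variation_measure)

lemma variation_UN_le:
  fixes A :: "nat \<Rightarrow> 'w::topological_space set"
  assumes "regular_bv_measure \<nu>" "\<And>i. A i \<in> sets borel"
  shows "variation \<nu> (\<Union>i. A i) \<le> (\<Sum>i. variation \<nu> (A i))"
proof -
  have "range A \<subseteq> sets (variation_measure \<nu>)" using assms(2) by (auto simp: sets_variation_measure)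
  from emeasure_subadditive_countably[OF this] show ?thesis
    using assms by (simp add: emeasure_variation_measure)
qed

lemma blinfun_almost_attains_norm:
  fixes \<phi> :: "'a::real_normed_vector \<Rightarrow>\<^sub>L real"
  assumes "\<delta> > 0"
  obtains x where "norm x \<le> 1" "norm \<phi> - \<delta> \<le> blinfun_apply \<phi> x"
proof -
  have "\<exists>x. norm x \<le> 1 \<and> norm \<phi> - \<delta> \<le> blinfun_apply \<phi> x"
  proof (rule ccontr)
    assume "\<not> ?thesis"
    then have less: "blinfun_apply \<phi> x < norm \<phi> - \<delta>" if "norm x \<le> 1" for x
      using that by fastforce
    have pos: "norm \<phi> - \<delta> > 0" using less[of 0] by (simp add: blinfun.zero_right)
    have bd: "blinfun_apply \<phi> x \<le> (norm \<phi> - \<delta>) * norm x" for x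
    proof (cases "x = 0")
      case False
      then show ?thesis
        using less[of "x /\<^sub>R norm x"] by (simp add: blinfun.scaleR_right field_simps)
    qed (simp add: blinfun.zero_right)
    have "norm \<phi> \<le> norm \<phi> - \<delta>"
      using pos bd bd[of "- x" for x]
      by (intro norm_blinfun_bound) (auto simp: blinfun.minus_right abs_le_iff)
    then show False using assms by simp
  qed
  then show ?thesis using that by blast
qed

text \<open>
  For each member of a partition take a vector of the unit ball at which its measure, a functional
  on \<open>X\<close>, almost attains its norm. With these vectors the sum in the definition of the
  semivariation almost reaches the one in the definition of the variation.
\<close>

lemma variation_functional_measure_le_semivariation:
  assumes "norm \<psi> \<le> 1"
  shows "variation (functional_measure m \<psi>) A \<le> semivariation m A"
  unfolding variation_def
proof (rule SUP_least)
  fix P assume P: "P \<in> Borel_partitions A"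
  let ?\<nu> = "functional_measure m \<psi>"
  show "ennreal (\<Sum>B\<in>P. norm (?\<nu> B)) \<le> semivariation m A"
  proof (rule ennreal_le_epsilon)
    fix e :: real assume e: "0 < e"
    define \<delta> where "\<delta> = e / (1 + card P)"
    have \<delta>: "\<delta> > 0" using e by (simp add: \<delta>_def)
    have "\<forall>B. \<exists>x. norm x \<le> 1 \<and> norm (?\<nu> B) - \<delta> \<le> blinfun_apply (?\<nu> B) x"
      using blinfun_almost_attains_norm[OF \<delta>] by metis
    then obtain x where x: "\<And>B. norm (x B) \<le> 1"
        "\<And>B. norm (?\<nu> B) - \<delta> \<le> blinfun_apply (?\<nu> B) (x B)" by metis
    let ?y = "\<Sum>B\<in>P. blinfun_apply (m B) (x B)"
    have "(\<Sum>B\<in>P. norm (?\<nu> B)) \<le> (\<Sum>B\<in>P. blinfun_apply (?\<nu> B) (x B) + \<delta>)"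
      using x(2) by (intro sum_mono) (simp add: algebra_simps)
    also have "\<dots> = blinfun_apply ?y \<psi> + card P * \<delta>"
      by (simp add: sum.distrib functional_measure_apply blinfun.sum_left)
    also have "card P * \<delta> \<le> e"
      using e by (simp add: \<delta>_def field_simps)
    also have "blinfun_apply ?y \<psi> \<le> norm ?y"
      using norm_blinfun[of ?y \<psi>] mult_left_mono[OF assms, of "norm ?y"] by simp
    finally have "ennreal (\<Sum>B\<in>P. norm (?\<nu> B)) \<le> ennreal (norm ?y + e)"
      by (intro ennreal_leI) simp
    also have "\<dots> = ennreal (norm ?y) + ennreal e" using e by simp
    also have "ennreal (norm ?y) \<le> semivariation m A"
      unfolding semivariation_def using P x(1) by (intro SUP_upper2[of "(P, x)"]) auto
    finally show "ennreal (\<Sum>B\<in>P. norm (?\<nu> B)) \<le> semivariation m A + ennreal e"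
      by (simp add: add_right_mono)
  qed
qed

text \<open>
  Regularity gives a compact \<open>K \<subseteq> A\<close> such that \<open>A - K\<close> has variation less than
  \<open>variation \<nu> A - e\<close>; what is left for \<open>K\<close> exceeds \<open>e\<close>.
\<close>

lemma compact_subset_variation_gt:
  fixes A :: "'w::t2_space set"
  assumes \<nu>: "regular_bv_measure \<nu>" and A: "A \<in> sets borel" and e: "e < variation \<nu> A"
  obtains K where "compact K" "K \<subseteq> A" "e < variation \<nu> K"
proof -
  have "variation \<nu> A \<le> variation \<nu> UNIV" using \<nu> A by (intro variation_mono) auto
  then have fin: "variation \<nu> A < \<infinity>" using \<nu> unfolding regular_bv_measure_def by (metis order_le_less_trans)
  define \<delta> where "\<delta> = variation \<nu> A - e"
  have "\<delta> > 0" using e by (simp add: \<delta>_def diff_gr0_ennreal)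
  then obtain K U where K: "compact K" "open U" "K \<subseteq> A" "A \<subseteq> U" "variation \<nu> (U - K) < \<delta>"
    using \<nu> A unfolding regular_bv_measure_def by meson
  have Kb: "K \<in> sets borel" using K(1) by (simp add: compact_imp_closed)
  have "variation \<nu> (A - K) \<le> variation \<nu> (U - K)"
    using K A Kb by (intro variation_mono[OF \<nu>]) auto
  then have less: "variation \<nu> (A - K) < \<delta>" using K(5) by simp
  have "e < variation \<nu> K"
  proof (rule ccontr)
    assume "\<not> e < variation \<nu> K"
    then have le: "variation \<nu> K \<le> e" by simp
    have "variation \<nu> A = variation \<nu> (K \<union> (A - K))" using K(3) by (simp add: Un_absorb1)
    also have "\<dots> \<le> variation \<nu> K + variation \<nu> (A - K)"
      using A Kb by (intro variation_Un_le[OF \<nu>]) auto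
    also have "\<dots> \<le> e + variation \<nu> (A - K)" using le by (rule add_right_mono)
    also have "\<dots> < e + \<delta>"
      using less e fin by (subst ennreal_add_left_cancel_less) (auto simp: less_top)
    also have "e + \<delta> = variation \<nu> A"
      unfolding \<delta>_def using e by (simp add: less_imp_le)
    finally show False by simp
  qed
  then show ?thesis using K that by blast
qed

text \<open>
  Here \<open>\<N>\<close> stands for the measures \<open>y* \<circ> m\<close> with \<open>\<parallel>y*\<parallel> \<le> 1\<close> and \<open>\<mu>\<close> for the semivariation of \<open>m\<close>.
  If no compact subset of \<open>A\<close> works, then from what remains after removing any compact set
  \<open>L\<close>, one more compact set \<open>F L\<close> with \<open>\<mu>(F L) > e\<close> can be removed. Repeating this produces
  disjoint sets that contradict the assumption on \<open>\<mu>\<close>. This takes the place of a control measure.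
\<close>

lemma uniform_inner_regularity:
  fixes \<N> :: "('w::t2_space set \<Rightarrow> 'e::real_normed_vector) set"
  assumes reg: "\<And>\<nu>. \<nu> \<in> \<N> \<Longrightarrow> regular_bv_measure \<nu>"
    and \<mu>: "\<And>\<nu> B. \<nu> \<in> \<N> \<Longrightarrow> variation \<nu> B \<le> \<mu> B"
    and null: "\<And>B :: nat \<Rightarrow> 'w set. range B \<subseteq> sets borel \<Longrightarrow> disjoint_family B \<Longrightarrow> (\<lambda>n. \<mu> (B n)) \<longlonglongrightarrow> 0"
    and A: "A \<in> sets borel" and e: "e > (0 :: ennreal)"
  obtains K where "compact K" "K \<subseteq> A" "\<forall>\<nu>\<in>\<N>. variation \<nu> (A - K) \<le> e"
proof -
  have "\<exists>K. compact K \<and> K \<subseteq> A \<and> (\<forall>\<nu>\<in>\<N>. variation \<nu> (A - K) \<le> e)"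
  proof (rule ccontr)
    assume "\<not> ?thesis"
    then have gt: "\<exists>\<nu>\<in>\<N>. e < variation \<nu> (A - K)" if "compact K" "K \<subseteq> A" for K
      using that by (meson not_le_imp_less)
    have "\<exists>L. compact L \<and> L \<subseteq> A - K \<and> e < \<mu> L" if K: "compact K" "K \<subseteq> A" for K
    proof -
      obtain \<nu> where \<nu>: "\<nu> \<in> \<N>" "e < variation \<nu> (A - K)" using gt[OF K] by blast
      have "A - K \<in> sets borel" using A K by (auto simp: compact_imp_closed)
      then show ?thesis
        using compact_subset_variation_gt[OF reg[OF \<nu>(1)] _ \<nu>(2)] \<mu>[OF \<nu>(1)]
        by (metis order_less_le_trans)
    qed
    then obtain F where F: "\<And>K. compact K \<Longrightarrow> K \<subseteq> A \<Longrightarrow> compact (F K)"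
        "\<And>K. compact K \<Longrightarrow> K \<subseteq> A \<Longrightarrow> F K \<subseteq> A - K" "\<And>K. compact K \<Longrightarrow> K \<subseteq> A \<Longrightarrow> e < \<mu> (F K)"
      by metis
    define L where "L n = ((\<lambda>K. K \<union> F K) ^^ n) {}" for n
    have L_Suc: "L (Suc n) = L n \<union> F (L n)" for n by (simp add: L_def)
    have L: "compact (L n) \<and> L n \<subseteq> A" for n
    proof (induction n)
      case (Suc n)
      then show ?case using F(1,2)[of "L n"] by (auto simp: L_Suc)
    qed (simp add: L_def)
    let ?B = "\<lambda>n. F (L n)"
    have mono: "L i \<subseteq> L j" if "i \<le> j" for i j
      using that by (rule lift_Suc_mono_le[rotated]) (simp add: L_Suc)
    have "?B i \<inter> ?B j = {}" if "i < j" for i j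
    proof -
      have "?B i \<subseteq> L j" using mono[of "Suc i" j] that by (auto simp: L_Suc)
      then show ?thesis using F(2)[of "L j"] L by blast
    qed
    then have "disjoint_family ?B"
      unfolding disjoint_family_on_def by (metis Int_commute linorder_neqE_nat)
    moreover have "range ?B \<subseteq> sets borel" using F(1) L by (auto simp: compact_imp_closed)
    ultimately have "(\<lambda>n. \<mu> (?B n)) \<longlonglongrightarrow> 0" by (rule null[rotated])
    then have "\<forall>\<^sub>F n in sequentially. \<mu> (?B n) < e" by (rule order_tendstoD(2)) (rule e)
    then obtain n where "\<mu> (?B n) < e" by (auto simp: eventually_sequentially)
    then show False using F(3) L by (meson order.asym)
  qed
  then show ?thesis using that by blast
qed


section \<open>Averages over random codes\<close>

text \<open>
  The expected value of \<open>F \<sigma>\<close> for a random set \<open>\<sigma> \<subseteq> {..<N}\<close> that contains each \<open>i\<close>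
  independently with probability \<open>a i\<close>.
\<close>

fun Bernoulli_mean :: "(nat \<Rightarrow> real) \<Rightarrow> nat \<Rightarrow> (nat set \<Rightarrow> 'x::real_vector) \<Rightarrow> 'x" where
  "Bernoulli_mean a 0 F = F {}"
| "Bernoulli_mean a (Suc N) F =
     (1 - a N) *\<^sub>R Bernoulli_mean a N F + a N *\<^sub>R Bernoulli_mean a N (\<lambda>\<sigma>. F (insert N \<sigma>))"

lemma Bernoulli_mean_cong:
  "(\<And>\<sigma>. \<sigma> \<subseteq> {..<N} \<Longrightarrow> F \<sigma> = G \<sigma>) \<Longrightarrow> Bernoulli_mean a N F = Bernoulli_mean a N G"
proof (induction N arbitrary: F G)
  case (Suc N)
  have "Bernoulli_mean a N F = Bernoulli_mean a N G"
    by (rule Suc.IH) (rule Suc.prems, auto)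
  moreover have "Bernoulli_mean a N (\<lambda>\<sigma>. F (insert N \<sigma>)) = Bernoulli_mean a N (\<lambda>\<sigma>. G (insert N \<sigma>))"
    by (rule Suc.IH) (rule Suc.prems, auto)
  ultimately show ?case by simp
qed simp

lemma Bernoulli_mean_add:
  "Bernoulli_mean a N (\<lambda>\<sigma>. F \<sigma> + G \<sigma>) = Bernoulli_mean a N F + Bernoulli_mean a N G"
  by (induction N arbitrary: F G) (auto simp: algebra_simps)

lemma Bernoulli_mean_scaleR:
  "Bernoulli_mean a N (\<lambda>\<sigma>. c *\<^sub>R F \<sigma>) = c *\<^sub>R Bernoulli_mean a N F"
  by (induction N arbitrary: F) (auto simp: algebra_simps)

lemma Bernoulli_mean_diff:
  "Bernoulli_mean a N (\<lambda>\<sigma>. F \<sigma> - G \<sigma>) = Bernoulli_mean a N F - Bernoulli_mean a N G"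
  using Bernoulli_mean_add[of a N "\<lambda>\<sigma>. F \<sigma> - G \<sigma>" G] by simp

lemma norm_Bernoulli_mean_le:
  fixes F :: "nat set \<Rightarrow> 'x::real_normed_vector"
  assumes "\<And>i. 0 \<le> a i" "\<And>i. a i \<le> 1" "\<And>\<sigma>. norm (F \<sigma>) \<le> c"
  shows "norm (Bernoulli_mean a N F) \<le> c"
  using assms(3)
proof (induction N arbitrary: F)
  case (Suc N)
  have "norm (Bernoulli_mean a (Suc N) F) \<le> (1 - a N) * c + a N * c"
    using assms(1,2)[of N] Suc.IH[of F] Suc.IH[of "\<lambda>\<sigma>. F (insert N \<sigma>)"] Suc.prems
    by (auto intro!: norm_triangle_le add_mono mult_left_mono)
  then show ?case by (simp add: algebra_simps)
qed simp

text \<open>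
  Averages for different numbers of bits become comparable, since further bits do not change the
  mean of a function of the first \<open>N\<close> bits.
\<close>

lemma Bernoulli_mean_restrict:
  assumes "N \<le> M"
  shows "Bernoulli_mean a M (\<lambda>\<sigma>. F (\<sigma> \<inter> {..<N})) = Bernoulli_mean a N F"
  using assms
proof (induction M rule: dec_induct)
  case base
  show ?case by (rule Bernoulli_mean_cong) (simp add: Int_absorb2)
next
  case (step M)
  have "insert M \<sigma> \<inter> {..<N} = \<sigma> \<inter> {..<N}" for \<sigma> using step.hyps by auto
  then show ?case using step.IH by (simp flip: scaleR_add_left)
qed

lemma Bernoulli_mean_deterministic:
  assumes "\<And>i. a i = (if i \<in> \<tau> then 1 else 0)"
  shows "Bernoulli_mean a N F = F (\<tau> \<inter> {..<N})"
proof (induction N arbitrary: F)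
  case (Suc N)
  have "\<tau> \<inter> {..<Suc N} = (if N \<in> \<tau> then insert N (\<tau> \<inter> {..<N}) else \<tau> \<inter> {..<N})"
    by (auto simp: less_Suc_eq)
  then show ?case using assms[of N] Suc.IH by simp
qed simp

lemma continuous_on_Bernoulli_mean:
  fixes F :: "nat set \<Rightarrow> 'x::real_normed_vector"
  assumes "\<And>i. continuous_on U (\<lambda>t. g t i)"
  shows "continuous_on U (\<lambda>t. Bernoulli_mean (g t) N F)"
  by (induction N arbitrary: F) (auto intro!: continuous_intros assms)


section \<open>Extension of functions from a set with clopen codes\<close>

text \<open>
  The code of a point \<open>s\<close> is the set of all \<open>i\<close> with \<open>s \<in> A i\<close>. Not every \<open>\<sigma>\<close> is the code of a
  point of \<open>K\<close>. The greedy choice follows \<open>\<sigma>\<close> bit by bit and ignores a bit of \<open>\<sigma>\<close> that no point of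
  \<open>K\<close> with the bits fixed so far has. The chosen point may change with \<open>N\<close>, but the first \<open>N\<close> bits of its
  code are fixed from step \<open>N\<close> on and depend on the first \<open>N\<close> bits of \<open>\<sigma>\<close> only. In this sense
  arbitrary codes are retracted to codes of points of \<open>K\<close> without increasing the Cantor metric.
\<close>

fun greedy_point :: "'w set \<Rightarrow> (nat \<Rightarrow> 'w set) \<Rightarrow> nat \<Rightarrow> nat set \<Rightarrow> 'w" where
  "greedy_point K A 0 \<sigma> = (SOME s. s \<in> K)"
| "greedy_point K A (Suc N) \<sigma> =
     (let s = greedy_point K A N \<sigma>;
          Q = \<lambda>s'. s' \<in> K \<and> (\<forall>i<N. s' \<in> A i \<longleftrightarrow> s \<in> A i) \<and> (s' \<in> A N \<longleftrightarrow> N \<in> \<sigma>)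
      in if \<exists>s'. Q s' then SOME s'. Q s' else s)"

lemma greedy_point_mem:
  assumes "K \<noteq> {}"
  shows "greedy_point K A N \<sigma> \<in> K"
proof (induction N)
  case 0
  show ?case using assms by (auto intro: someI)
next
  case (Suc N)
  let ?s = "greedy_point K A N \<sigma>"
  let ?Q = "\<lambda>s'. s' \<in> K \<and> (\<forall>i<N. s' \<in> A i \<longleftrightarrow> ?s \<in> A i) \<and> (s' \<in> A N \<longleftrightarrow> N \<in> \<sigma>)"
  show ?case
    using Suc someI_ex[of ?Q] by (auto simp: Let_def)
qed

lemma greedy_point_cong:
  "(\<And>i. i < N \<Longrightarrow> i \<in> \<sigma> \<longleftrightarrow> i \<in> \<tau>) \<Longrightarrow> greedy_point K A N \<sigma> = greedy_point K A N \<tau>"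
  by (induction N) (auto simp: Let_def)

lemma greedy_point_code_Suc:
  assumes "i < N"
  shows "greedy_point K A (Suc N) \<sigma> \<in> A i \<longleftrightarrow> greedy_point K A N \<sigma> \<in> A i"
proof -
  let ?s = "greedy_point K A N \<sigma>"
  let ?Q = "\<lambda>s'. s' \<in> K \<and> (\<forall>i<N. s' \<in> A i \<longleftrightarrow> ?s \<in> A i) \<and> (s' \<in> A N \<longleftrightarrow> N \<in> \<sigma>)"
  show ?thesis
    using assms someI_ex[of ?Q] by (auto simp: Let_def)
qed

lemma greedy_point_code:
  assumes "N \<le> M" "i < N"
  shows "greedy_point K A M \<sigma> \<in> A i \<longleftrightarrow> greedy_point K A N \<sigma> \<in> A i"
  using assms(1)
proof (induction M rule: dec_induct)
  case (step M)
  then show ?case using greedy_point_code_Suc[of i M K A \<sigma>] assms(2) by simp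
qed simp

lemma greedy_point_code_of_member:
  assumes "t \<in> K" "i < N"
  shows "greedy_point K A N {j. t \<in> A j} \<in> A i \<longleftrightarrow> t \<in> A i"
  using assms(2)
proof (induction N arbitrary: i)
  case (Suc N)
  let ?s = "greedy_point K A N {j. t \<in> A j}"
  let ?Q = "\<lambda>s'. s' \<in> K \<and> (\<forall>i<N. s' \<in> A i \<longleftrightarrow> ?s \<in> A i) \<and> (s' \<in> A N \<longleftrightarrow> t \<in> A N)"
  have "\<exists>s'. ?Q s'" using Suc.IH assms(1) by blast
  then have "?Q (greedy_point K A (Suc N) {j. t \<in> A j})"
    using someI_ex[of ?Q] by (simp add: Let_def)
  then show ?case using Suc.IH Suc.prems less_Suc_eq by blast
qed simp

text \<open>
  The hypothesis on \<open>f\<close> says that on \<open>K\<close> its value is uniformly continuous as a function of the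
  code. \<open>S N f t\<close> is the mean of \<open>f\<close> over greedy points for random codes of length \<open>N\<close>, whose
  bit probabilities are \<open>g i t\<close>. These means form a Cauchy sequence uniformly in \<open>t\<close>, since greedy
  points for codes with a common long initial part have close \<open>f\<close>-values; for \<open>t \<in> K\<close> the
  code is deterministic, namely that of \<open>t\<close>, so the limit is \<open>f t\<close>.
\<close>

lemma continuous_extension_operators:
  fixes g :: "nat \<Rightarrow> 'w::topological_space \<Rightarrow> real" and K :: "'w set" and A :: "nat \<Rightarrow> 'w set"
  assumes K: "K \<noteq> {}" and cont: "\<And>i. continuous_on UNIV (g i)"
    and g01: "\<And>i t. 0 \<le> g i t" "\<And>i t. g i t \<le> 1"
    and gK: "\<And>i t. t \<in> K \<Longrightarrow> g i t = (if t \<in> A i then 1 else 0)"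
  obtains S :: "nat \<Rightarrow> ('w \<Rightarrow>\<^sub>B 'x::banach) \<Rightarrow>\<^sub>L ('w \<Rightarrow>\<^sub>C 'x)"
  where "\<forall>N. norm (S N) \<le> 1"
    and "\<forall>f. (\<forall>e>0. \<exists>N. \<forall>s\<in>K. \<forall>t\<in>K. (\<forall>i<N. s \<in> A i \<longleftrightarrow> t \<in> A i) \<longrightarrow>
              norm (apply_bmeasfun f s - apply_bmeasfun f t) \<le> e) \<longrightarrow>
           (\<exists>h. (\<lambda>N. blinfun_apply (S N) f) \<longlonglongrightarrow> h \<and> (\<forall>t\<in>K. apply_bcontfun h t = apply_bmeasfun f t))"
proof -
  let ?r = "greedy_point K A"
  define s where "s N f t = Bernoulli_mean (\<lambda>i. g i t) N (\<lambda>\<sigma>. apply_bmeasfun f (?r N \<sigma>))"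
    for N and f :: "'w \<Rightarrow>\<^sub>B 'x" and t
  have bd: "norm (s N f t) \<le> norm f" for N f t
    unfolding s_def by (intro norm_Bernoulli_mean_le g01 norm_bmeasfun_upper)
  have cs: "s N f \<in> bcontfun" for N f
  proof (rule bcontfun_normI)
    show "continuous_on UNIV (s N f)"
      unfolding s_def by (intro continuous_on_Bernoulli_mean cont)
  qed (rule bd)
  define S0 where "S0 N f = Bcontfun (s N f)" for N f
  have S0: "apply_bcontfun (S0 N f) t = s N f t" for N f t
    using cs by (simp add: S0_def Bcontfun_inverse)
  have lin: "bounded_linear (S0 N)" for N
  proof (rule bounded_linear_intro[where K = 1])
    show "norm (S0 N f) \<le> norm f * 1" for f
      by (rule norm_bound) (simp add: S0 bd)
  qed (auto intro!: bcontfun_eqI simp: S0 s_def plus_bmeasfun.rep_eq scaleR_bmeasfun.rep_eq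
        Bernoulli_mean_add Bernoulli_mean_scaleR)
  note ap = bounded_linear_Blinfun_apply[OF lin]
  show ?thesis
  proof (rule that[of "\<lambda>N. Blinfun (S0 N)"])
    show "\<forall>N. norm (Blinfun (S0 N)) \<le> 1"
      by (intro allI norm_blinfun_bound) (auto simp: ap S0 intro!: norm_bound bd)
  next
    show "\<forall>f. (\<forall>e>0. \<exists>N. \<forall>s\<in>K. \<forall>t\<in>K. (\<forall>i<N. s \<in> A i \<longleftrightarrow> t \<in> A i) \<longrightarrow>
              norm (apply_bmeasfun f s - apply_bmeasfun f t) \<le> e) \<longrightarrow>
           (\<exists>h. (\<lambda>N. blinfun_apply (Blinfun (S0 N)) f) \<longlonglongrightarrow> h \<and>
              (\<forall>t\<in>K. apply_bcontfun h t = apply_bmeasfun f t))"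
    proof (intro allI impI)
      fix f :: "'w \<Rightarrow>\<^sub>B 'x"
      assume f: "\<forall>e>0. \<exists>N. \<forall>s\<in>K. \<forall>t\<in>K. (\<forall>i<N. s \<in> A i \<longleftrightarrow> t \<in> A i) \<longrightarrow>
          norm (apply_bmeasfun f s - apply_bmeasfun f t) \<le> e"
      note rK = greedy_point_mem[OF K]
      have close: "\<exists>N0. \<forall>N\<ge>N0. (\<forall>M\<ge>N. norm (S0 M f - S0 N f) \<le> e) \<and> (\<forall>t\<in>K. norm (s N f t - apply_bmeasfun f t) \<le> e)"
        if e: "e > 0" for e
      proof -
        obtain N0 where N0: "\<And>u v. u \<in> K \<Longrightarrow> v \<in> K \<Longrightarrow> (\<And>i. i < N0 \<Longrightarrow> u \<in> A i \<longleftrightarrow> v \<in> A i) \<Longrightarrow>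
            norm (apply_bmeasfun f u - apply_bmeasfun f v) \<le> e"
          using f[THEN spec, THEN mp, OF e] by metis
        have "norm (S0 M f - S0 N f) \<le> e" if "N \<ge> N0" "M \<ge> N" for M N
        proof (rule norm_bound)
          fix t
          have "s N f t = Bernoulli_mean (\<lambda>i. g i t) M (\<lambda>\<sigma>. apply_bmeasfun f (?r N (\<sigma> \<inter> {..<N})))"
            unfolding s_def by (rule Bernoulli_mean_restrict[OF that(2), symmetric])
          also have "(\<lambda>\<sigma>. apply_bmeasfun f (?r N (\<sigma> \<inter> {..<N}))) = (\<lambda>\<sigma>. apply_bmeasfun f (?r N \<sigma>))"
            by (intro ext arg_cong[where f = "apply_bmeasfun f"] greedy_point_cong) auto
          finally have "s M f t - s N f t = Bernoulli_mean (\<lambda>i. g i t) M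
              (\<lambda>\<sigma>. apply_bmeasfun f (?r M \<sigma>) - apply_bmeasfun f (?r N \<sigma>))"
            by (simp add: s_def Bernoulli_mean_diff)
          also have "norm \<dots> \<le> e"
          proof (intro norm_Bernoulli_mean_le g01 N0 rK)
            show "?r M \<sigma> \<in> A i \<longleftrightarrow> ?r N \<sigma> \<in> A i" if "i < N0" for i \<sigma>
              using that \<open>N \<ge> N0\<close> \<open>M \<ge> N\<close> by (intro greedy_point_code) auto
          qed
          finally show "norm (apply_bcontfun (S0 M f - S0 N f) t) \<le> e" by (simp add: S0)
        qed
        moreover have "norm (s N f t - apply_bmeasfun f t) \<le> e" if "N \<ge> N0" "t \<in> K" for N t
        proof -
          have "s N f t = apply_bmeasfun f (?r N ({j. t \<in> A j} \<inter> {..<N}))"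
            unfolding s_def by (rule Bernoulli_mean_deterministic) (use gK[OF that(2)] in simp)
          also have "?r N ({j. t \<in> A j} \<inter> {..<N}) = ?r N {j. t \<in> A j}"
            by (rule greedy_point_cong) auto
          finally show ?thesis
            using greedy_point_code_of_member[OF that(2), of _ N A] that
            by (simp only:, intro N0 rK) auto
        qed
        ultimately show ?thesis by blast
      qed
      have "Cauchy (\<lambda>N. S0 N f)"
      proof (rule metric_CauchyI)
        fix e :: real assume "e > 0"
        then obtain N0 where N0: "\<And>N M. N0 \<le> N \<Longrightarrow> N \<le> M \<Longrightarrow> norm (S0 M f - S0 N f) \<le> e / 2"
          using close[of "e / 2"] by auto
        have "dist (S0 m f) (S0 n f) < e" if "N0 \<le> m" "N0 \<le> n" for m n
          using N0[of m n] N0[of n m] that \<open>e > 0\<close>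
          by (cases m n rule: le_cases) (auto simp: dist_norm norm_minus_commute)
        then show "\<exists>M. \<forall>m\<ge>M. \<forall>n\<ge>M. dist (S0 m f) (S0 n f) < e" by blast
      qed
      then obtain h where h: "(\<lambda>N. S0 N f) \<longlonglongrightarrow> h" using Cauchy_convergent convergentD by blast
      have "apply_bcontfun h t = apply_bmeasfun f t" if t: "t \<in> K" for t
      proof (rule LIMSEQ_unique)
        show "(\<lambda>N. s N f t) \<longlonglongrightarrow> apply_bcontfun h t"
          using tendsto_uniform_limitI[OF tendsto_bcontfun_uniform_limit[OF h]] by (simp add: S0)
        show "(\<lambda>N. s N f t) \<longlonglongrightarrow> apply_bmeasfun f t"
        proof (rule LIMSEQ_I)
          fix e :: real assume "e > 0"
          then have "\<exists>N0. \<forall>N\<ge>N0. norm (s N f t - apply_bmeasfun f t) \<le> e / 2" "e / 2 < e"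
            using close[of "e / 2"] t by auto
          then show "\<exists>N0. \<forall>N\<ge>N0. norm (s N f t - apply_bmeasfun f t) < e"
            by (meson order_le_less_trans)
        qed
      qed
      then show "\<exists>h. (\<lambda>N. blinfun_apply (Blinfun (S0 N)) f) \<longlonglongrightarrow> h \<and>
          (\<forall>t\<in>K. apply_bcontfun h t = apply_bmeasfun f t)"
        using h by (auto simp: ap)
    qed
  qed
qed


section \<open>Lifting of functionals along approximating operators\<close>

text \<open>
  For each \<open>\<Phi>\<close> and \<open>f\<close> the numbers \<open>\<Phi> (S N f)\<close> lie in a compact interval. By Tychonoff's theorem
  these families, as \<open>N\<close> varies, have a cluster point \<open>l\<close> in the product topology. Linear
  relations and norm bounds, which hold for all \<open>N\<close>, persist for \<open>l\<close>, and where \<open>S N f\<close>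
  converges in norm \<open>l\<close> must be the limit.
\<close>

lemma dual_lifting_of_approximating_operators:
  fixes S :: "nat \<Rightarrow> 'a::real_normed_vector \<Rightarrow>\<^sub>L 'b::real_normed_vector"
  assumes c: "\<And>N. norm (S N) \<le> c"
  obtains E :: "('b \<Rightarrow>\<^sub>L real) \<Rightarrow>\<^sub>L ('a \<Rightarrow>\<^sub>L real)"
  where "\<forall>f h \<Phi>. (\<lambda>N. blinfun_apply (S N) f) \<longlonglongrightarrow> h \<longrightarrow>
           blinfun_apply (blinfun_apply E \<Phi>) f = blinfun_apply \<Phi> h"
proof -
  define a where "a N = (\<lambda>(\<Phi> :: 'b \<Rightarrow>\<^sub>L real, f). blinfun_apply \<Phi> (blinfun_apply (S N) f))" for N
  define P where "P = (\<Pi>\<^sub>E z\<in>UNIV. cball (0::real) (c * norm (fst z :: 'b \<Rightarrow>\<^sub>L real) * norm (snd z :: 'a)))"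
  have bound: "\<bar>a N (\<Phi>, f)\<bar> \<le> c * norm \<Phi> * norm f" for N \<Phi> f
  proof -
    have "\<bar>a N (\<Phi>, f)\<bar> \<le> norm \<Phi> * norm (blinfun_apply (S N) f)"
      using norm_blinfun[of \<Phi> "blinfun_apply (S N) f"] by (simp add: a_def)
    also have "\<dots> \<le> norm \<Phi> * (c * norm f)"
      by (intro mult_left_mono order_trans[OF norm_blinfun] mult_right_mono c) auto
    finally show ?thesis by (simp add: algebra_simps)
  qed
  have "compact P"
    unfolding P_def compactin_euclidean_iff[symmetric] euclidean_product_topology[symmetric]
    by (subst compactin_PiE) (auto simp: compactin_euclidean_iff)
  moreover have "\<forall>\<^sub>F x in filtermap a sequentially. x \<in> P"
    unfolding eventually_filtermap
  proof (intro always_eventually allI)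
    fix N
    show "a N \<in> P" using bound[of N] by (auto simp: P_def PiE_def)
  qed
  moreover have "filtermap a sequentially \<noteq> bot" by (simp add: filtermap_bot_iff)
  ultimately obtain l where l: "inf (nhds l) (filtermap a sequentially) \<noteq> bot"
    unfolding compact_filter by blast
  \<comment> \<open>Along \<open>G\<close> every coordinate converges, and \<open>G\<close> lives on the functions \<open>a N\<close>.\<close>
  define G where "G = inf (nhds l) (filtermap a sequentially)"
  have G: "G \<noteq> bot" using l by (simp add: G_def)
  have ev: "\<forall>\<^sub>F x in G. \<exists>N. x = a N"
  proof -
    have "\<forall>\<^sub>F x in filtermap a sequentially. \<exists>N. x = a N"
      unfolding eventually_filtermap by (rule always_eventually) blast
    then show ?thesis using filter_leD inf_le2 unfolding G_def by blast
  qed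
  have lim: "((\<lambda>x. x z) \<longlongrightarrow> l z) G" for z
  proof -
    have "((\<lambda>x. x z) \<longlongrightarrow> l z) (nhds l)"
      using continuous_on_product_coordinates[of z] tendsto_at_iff_tendsto_nhds[of "\<lambda>x. x z" l]
      unfolding continuous_on_def by blast
    then show ?thesis by (rule tendsto_mono[rotated]) (simp add: G_def)
  qed
  have eqI: "u = v" if "(F \<longlongrightarrow> u) G" "(F' \<longlongrightarrow> v) G" "\<And>N. F (a N) = F' (a N)" for F F' :: "_ \<Rightarrow> real" and u v
  proof (rule tendsto_unique[OF G])
    show "(F' \<longlongrightarrow> v) G" by fact
    show "(F' \<longlongrightarrow> u) G"
      using that(1) by (rule Lim_transform_eventually) (use ev that(3) in \<open>auto elim: eventually_mono\<close>)
  qed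
  have add1: "l (\<Phi>, f + f') = l (\<Phi>, f) + l (\<Phi>, f')" for \<Phi> f f'
    by (rule eqI[OF lim tendsto_add[OF lim lim]]) (simp add: a_def blinfun.add_right)
  have scale1: "l (\<Phi>, r *\<^sub>R f) = r * l (\<Phi>, f)" for \<Phi> f r
    by (rule eqI[OF lim tendsto_mult_left[OF lim]]) (simp add: a_def blinfun.scaleR_right)
  have add2: "l (\<Phi> + \<Phi>', f) = l (\<Phi>, f) + l (\<Phi>', f)" for \<Phi> \<Phi>' f
    by (rule eqI[OF lim tendsto_add[OF lim lim]]) (simp add: a_def blinfun.add_left)
  have scale2: "l (r *\<^sub>R \<Phi>, f) = r * l (\<Phi>, f)" for \<Phi> f r
    by (rule eqI[OF lim tendsto_mult_left[OF lim]]) (simp add: a_def blinfun.scaleR_left)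
  have bd: "\<bar>l (\<Phi>, f)\<bar> \<le> c * norm \<Phi> * norm f" for \<Phi> f
    by (rule tendsto_upperbound[OF tendsto_rabs[OF lim] _ G]) (use ev bound in \<open>auto elim!: eventually_mono\<close>)
  have c0: "c \<ge> 0" using c[of 0] norm_ge_zero order_trans by blast
  have lin1: "bounded_linear (\<lambda>f. l (\<Phi>, f))" for \<Phi>
    by (rule bounded_linear_intro[where K = "c * norm \<Phi>"])
      (use bd in \<open>auto simp: add1 scale1 mult.commute\<close>)
  define L where "L \<Phi> = Blinfun (\<lambda>f. l (\<Phi>, f))" for \<Phi>
  have L: "blinfun_apply (L \<Phi>) f = l (\<Phi>, f)" for \<Phi> f
    by (simp add: L_def bounded_linear_Blinfun_apply[OF lin1])
  have lin2: "bounded_linear L"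
  proof (rule bounded_linear_intro[where K = c])
    show "norm (L \<Phi>) \<le> norm \<Phi> * c" for \<Phi>
      by (rule norm_blinfun_bound) (use bd c0 in \<open>auto simp: L mult.commute\<close>)
  qed (auto intro!: blinfun_eqI simp: L add2 scale2 blinfun.add_left blinfun.scaleR_left)
  show ?thesis
  proof (rule that[of "Blinfun L"], intro allI impI)
    fix f h \<Phi> assume "(\<lambda>N. blinfun_apply (S N) f) \<longlonglongrightarrow> h"
    then have "(\<lambda>N. a N (\<Phi>, f)) \<longlonglongrightarrow> blinfun_apply \<Phi> h"
      by (auto simp: a_def intro!: tendsto_intros)
    then have "((\<lambda>x. x (\<Phi>, f)) \<longlongrightarrow> blinfun_apply \<Phi> h) (filtermap a sequentially)"
      by (simp add: filterlim_filtermap)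
    then have "((\<lambda>x. x (\<Phi>, f)) \<longlongrightarrow> blinfun_apply \<Phi> h) G"
      by (rule tendsto_mono[rotated]) (simp add: G_def)
    then have "l (\<Phi>, f) = blinfun_apply \<Phi> h" by (rule tendsto_unique[OF G lim])
    then show "blinfun_apply (blinfun_apply (Blinfun L) \<Phi>) f = blinfun_apply \<Phi> h"
      by (simp add: bounded_linear_Blinfun_apply[OF lin2] L)
  qed
qed

text \<open>
  In the following two lemmas, \<open>E\<close> may be thought of as an adjoint of a map sending \<open>x n\<close> to
  \<open>y n\<close>; such a map need not exist on the whole space.
\<close>

lemma weakly_p_summable_dual_lift:
  fixes E :: "('b::banach \<Rightarrow>\<^sub>L real) \<Rightarrow>\<^sub>L ('a::banach \<Rightarrow>\<^sub>L real)"
  assumes "\<And>\<Phi> n. blinfun_apply (blinfun_apply E \<Phi>) (x n) = blinfun_apply \<Phi> (y n)"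
    and "weakly_p_summable p x"
  shows "weakly_p_summable p y"
  using assms(2) unfolding weakly_p_summable_def assms(1)[symmetric] by blast

text \<open>
  \<open>E\<close> is bounded, hence it preserves weakly null sequences of functionals; on \<open>y n\<close> these take the
  values that their images take on \<open>x n\<close>.
\<close>

lemma Dunford_Pettis_set_dual_lift:
  fixes E :: "('b::banach \<Rightarrow>\<^sub>L real) \<Rightarrow>\<^sub>L ('a::banach \<Rightarrow>\<^sub>L real)"
  assumes E: "\<And>\<Phi> n. blinfun_apply (blinfun_apply E \<Phi>) (x n) = blinfun_apply \<Phi> (y n)"
    and x: "Dunford_Pettis_set (range x)" and bd: "bounded (range y)"
  shows "Dunford_Pettis_set (range y)"
  unfolding Dunford_Pettis_set_def
proof (intro conjI allI impI)
  fix \<phi> :: "nat \<Rightarrow> 'b \<Rightarrow>\<^sub>L real" assume \<phi>: "weakly_null \<phi>"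
  have "weakly_null (\<lambda>k. blinfun_apply E (\<phi> k))"
    unfolding weakly_null_def
  proof
    fix \<Theta> :: "('a \<Rightarrow>\<^sub>L real) \<Rightarrow>\<^sub>L real"
    show "(\<lambda>k. blinfun_apply \<Theta> (blinfun_apply E (\<phi> k))) \<longlonglongrightarrow> 0"
      using \<phi>[unfolded weakly_null_def, rule_format, of "\<Theta> o\<^sub>L E"] by simp
  qed
  then have "uniform_limit (range x) (\<lambda>k. blinfun_apply (blinfun_apply E (\<phi> k))) (\<lambda>_. 0) sequentially"
    using x by (simp add: Dunford_Pettis_set_def)
  then show "uniform_limit (range y) (\<lambda>k. blinfun_apply (\<phi> k)) (\<lambda>_. 0) sequentially"
    by (simp add: uniform_limit_iff E)
qed (rule bd)


section \<open>Continuous representatives of a sequence of Borel functions\<close>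

text \<open>
  Preimages of balls of radius \<open>1/(n+1)\<close> around the points of a countable set that is dense in the
  range.
\<close>

lemma bmeasfun_countable_fine_cover:
  fixes f :: "'w::topological_space \<Rightarrow> 'x::metric_space"
  assumes f: "f \<in> bmeasfun"
  obtains B :: "nat \<Rightarrow> 'w set" where "\<And>i. B i \<in> sets borel"
    and "\<And>e t. e > 0 \<Longrightarrow> \<exists>i. t \<in> B i \<and> (\<forall>s\<in>B i. \<forall>s'\<in>B i. dist (f s) (f s') \<le> e)"
proof -
  obtain D where D: "countable D" "range f \<subseteq> closure D"
    using f by (auto simp: bmeasfun_def separable_space_subset_closure_iff)
  have fm: "f \<in> borel_measurable borel" using f by (simp add: bmeasfun_def)
  define B where "B i = (case prod_decode i of (j, n) \<Rightarrow> f -` ball (from_nat_into D j) (inverse (Suc n)))" for i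
  show ?thesis
  proof (rule that)
    show "B i \<in> sets borel" for i
      using measurable_sets[OF fm] by (auto simp: B_def split: prod.split)
    fix e :: real and t assume "e > 0"
    then obtain n where n: "inverse (real (Suc n)) < e / 2" using reals_Archimedean[of "e / 2"] by auto
    have "f t \<in> closure D" using D(2) by auto
    then obtain d where d: "d \<in> D" "dist d (f t) < inverse (real (Suc n))"
      unfolding closure_approachable by (meson inverse_positive_iff_positive of_nat_0_less_iff zero_less_Suc)
    obtain j where j: "from_nat_into D j = d" using from_nat_into_surj[OF D(1) d(1)] by blast
    have B: "B (prod_encode (j, n)) = f -` ball d (inverse (Suc n))" by (simp add: B_def j)
    have "dist (f s) (f s') \<le> e" if "s \<in> f -` ball d (inverse (Suc n))" "s' \<in> f -` ball d (inverse (Suc n))" for s s'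
      using that n dist_triangle3[of "f s" "f s'" d] by auto
    then show "\<exists>i. t \<in> B i \<and> (\<forall>s\<in>B i. \<forall>s'\<in>B i. dist (f s) (f s') \<le> e)"
      using d(2) by (intro exI[of _ "prod_encode (j, n)"]) (auto simp: B)
  qed
qed

text \<open>
  For each \<open>t \<in> K\<close> some \<open>A i\<close> with small oscillation of \<open>f\<close> contains \<open>t\<close>; finitely many of these
  cover \<open>K\<close> by compactness. Points that agree on the finitely many indices lie in a common one.
\<close>

lemma finite_code_determines_value:
  fixes f :: "'w::t2_space \<Rightarrow> 'x::metric_space" and A :: "nat \<Rightarrow> 'w set"
  assumes K: "compact K" and open_A: "\<And>i. openin (top_of_set K) (K \<inter> A i)"
    and cover: "\<And>t. t \<in> K \<Longrightarrow> \<exists>i. t \<in> A i \<and> (\<forall>s\<in>A i. \<forall>s'\<in>A i. dist (f s) (f s') \<le> e)"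
  shows "\<exists>N. \<forall>s\<in>K. \<forall>t\<in>K. (\<forall>i<N. s \<in> A i \<longleftrightarrow> t \<in> A i) \<longrightarrow> dist (f s) (f t) \<le> e"
proof -
  define I where "I = {i. \<forall>s\<in>A i. \<forall>s'\<in>A i. dist (f s) (f s') \<le> e}"
  have "\<exists>U. \<forall>i. open (U i) \<and> K \<inter> A i = K \<inter> U i"
    using open_A unfolding openin_open by metis
  then obtain U where U: "\<And>i. open (U i)" "\<And>i. K \<inter> A i = K \<inter> U i" by blast
  have "K \<subseteq> (\<Union>i\<in>I. U i)"
  proof
    fix t assume t: "t \<in> K"
    then obtain i where "i \<in> I" "t \<in> A i" using cover I_def by blast
    then show "t \<in> (\<Union>i\<in>I. U i)" using U(2)[of i] t by blast
  qed
  then obtain J where J: "J \<subseteq> I" "finite J" "K \<subseteq> (\<Union>i\<in>J. U i)"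
    using compactE_image[OF K, of I U] U(1) by blast
  obtain N where N: "\<And>i. i \<in> J \<Longrightarrow> i < N"
    using finite_nat_bounded[OF J(2)] by blast
  have "dist (f s) (f t) \<le> e" if st: "s \<in> K" "t \<in> K" "\<forall>i<N. s \<in> A i \<longleftrightarrow> t \<in> A i" for s t
  proof -
    obtain i where i: "i \<in> J" "s \<in> U i" using J(3) st(1) by auto
    then have "s \<in> A i" using U(2)[of i] st(1) by blast
    moreover have "t \<in> A i" using N[OF i(1)] st(3) calculation by blast
    ultimately show ?thesis using i(1) J(1) unfolding I_def by blast
  qed
  then show ?thesis by blast
qed

lemma Urysohn_compact_Hausdorff:
  fixes K L :: "'w::t2_space set"
  assumes "compact (UNIV :: 'w set)" "compact K" "compact L" "K \<inter> L = {}"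
  obtains g :: "'w \<Rightarrow> real" where "continuous_on UNIV g" "\<And>t. 0 \<le> g t" "\<And>t. g t \<le> 1"
    "\<And>t. t \<in> K \<Longrightarrow> g t = 1" "\<And>t. t \<in> L \<Longrightarrow> g t = 0"
proof -
  have "normal_space (euclidean :: 'w topology)"
  proof (rule compact_Hausdorff_or_regular_imp_normal_space)
    have "Hausdorff_space (euclidean :: 'w topology)"
      unfolding Hausdorff_space_def by (simp add: disjnt_def) (meson hausdorff)
    then show "Hausdorff_space (euclidean :: 'w topology) \<or> regular_space (euclidean :: 'w topology)" ..
  qed (use assms(1) in \<open>simp add: compact_space_def compactin_euclidean_iff\<close>)
  moreover have "closedin euclidean L" "closedin euclidean K" "disjnt L K"
    using assms by (auto simp: compact_imp_closed disjnt_def)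
  ultimately obtain g where g: "continuous_map euclidean (top_of_set {0..1::real}) g" "g ` L \<subseteq> {0}" "g ` K \<subseteq> {1}"
    using Urysohn_lemma[of euclidean L K 0 1] by auto
  show ?thesis
    by (rule that[of g]) (use g in \<open>auto simp: continuous_map_in_subtopology image_subset_iff Pi_iff\<close>)
qed

text \<open>
  The range is a compact subset of a metric space, hence separable.
\<close>

lemma bcontfun_imp_bmeasfun:
  fixes h :: "'w::topological_space \<Rightarrow>\<^sub>C 'x::metric_space"
  assumes "compact (UNIV :: 'w set)"
  shows "apply_bcontfun h \<in> bmeasfun"
proof -
  have comp: "compact (range (apply_bcontfun h))" by (rule compact_continuous_image[OF _ assms]) simp
  then have "\<exists>F. finite F \<and> range (apply_bcontfun h) \<subseteq> (\<Union>x\<in>F. ball x (inverse (Suc n)))" for n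
    unfolding compact_eq_totally_bounded by simp
  then obtain F where F: "\<And>n. finite (F n)" "\<And>n. range (apply_bcontfun h) \<subseteq> (\<Union>x\<in>F n. ball x (inverse (Suc n)))"
    by metis
  have "range (apply_bcontfun h) \<subseteq> closure (\<Union>n. F n)"
  proof (intro subsetI, subst closure_approachable, intro allI impI)
    fix y and e :: real assume y: "y \<in> range (apply_bcontfun h)" and "e > 0"
    then obtain n where n: "inverse (real (Suc n)) < e" using reals_Archimedean by blast
    obtain x where x: "x \<in> F n" "dist x y < inverse (Suc n)" using F(2)[of n] y by fastforce
    show "\<exists>x\<in>\<Union>n. F n. dist x y < e" using x n by (intro bexI[of _ x]) auto
  qed
  moreover have "countable (\<Union>n. F n)" using F(1) by (intro countable_UN) (auto simp: countable_finite)
  moreover have "apply_bcontfun h \<in> borel_measurable borel"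
    by (intro borel_measurable_continuous_onI) simp
  ultimately show ?thesis
    using compact_imp_bounded[OF comp] unfolding bmeasfun_def separable_space_subset_closure_iff by blast
qed

text \<open>
  All codes are taken from the fine covers for all \<open>x n\<close> at once, enumerated as a single sequence
  \<open>A j\<close>. The compact sets \<open>P j \<subseteq> A j\<close> and \<open>Q j \<subseteq> - A j\<close> leave out so little that the
  intersection \<open>K\<close> of the \<open>P j \<union> Q j\<close> leaves out at most \<open>e\<close>; on \<open>K\<close>, membership in \<open>A j\<close> is
  the same as membership in \<open>P j\<close>, and as non-membership in \<open>Q j\<close>. The \<open>h n\<close> are the limits that
  the extension operators provide.
\<close>

lemma continuous_representatives:
  fixes \<N> :: "('w::t2_space set \<Rightarrow> 'e::real_normed_vector) set"
    and x :: "nat \<Rightarrow> 'w \<Rightarrow>\<^sub>B 'x::banach"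
  assumes comp: "compact (UNIV :: 'w set)"
    and reg: "\<And>\<nu>. \<nu> \<in> \<N> \<Longrightarrow> regular_bv_measure \<nu>"
    and \<mu>: "\<And>\<nu> B. \<nu> \<in> \<N> \<Longrightarrow> variation \<nu> B \<le> \<mu> B"
    and null: "\<And>B :: nat \<Rightarrow> 'w set. range B \<subseteq> sets borel \<Longrightarrow> disjoint_family B \<Longrightarrow> (\<lambda>n. \<mu> (B n)) \<longlonglongrightarrow> 0"
    and e: "e > (0 :: real)"
  obtains K h and E :: "(('w \<Rightarrow>\<^sub>C 'x) \<Rightarrow>\<^sub>L real) \<Rightarrow>\<^sub>L (('w \<Rightarrow>\<^sub>B 'x) \<Rightarrow>\<^sub>L real)"
  where "K \<in> sets borel" "\<And>\<nu>. \<nu> \<in> \<N> \<Longrightarrow> variation \<nu> (UNIV - K) \<le> ennreal e"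
    and "\<And>n t. t \<in> K \<Longrightarrow> apply_bcontfun (h n) t = apply_bmeasfun (x n) t"
    and "\<And>n. norm (h n) \<le> norm (x n)"
    and "\<And>\<Phi> n. blinfun_apply (blinfun_apply E \<Phi>) (x n) = blinfun_apply \<Phi> (h n)"
proof -
  have "\<forall>n. \<exists>B :: nat \<Rightarrow> 'w set. (\<forall>i. B i \<in> sets borel) \<and> (\<forall>e>0. \<forall>t. \<exists>i. t \<in> B i \<and>
      (\<forall>s\<in>B i. \<forall>s'\<in>B i. dist (apply_bmeasfun (x n) s) (apply_bmeasfun (x n) s') \<le> e))"
    using bmeasfun_countable_fine_cover[OF apply_bmeasfun] by metis
  then obtain B :: "nat \<Rightarrow> nat \<Rightarrow> 'w set" where B: "\<And>n i. B n i \<in> sets borel"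
      "\<And>n e t. e > 0 \<Longrightarrow> \<exists>i. t \<in> B n i \<and>
      (\<forall>s\<in>B n i. \<forall>s'\<in>B n i. dist (apply_bmeasfun (x n) s) (apply_bmeasfun (x n) s') \<le> e)"
    by metis
  define A where "A j = (case prod_decode j of (n, i) \<Rightarrow> B n i)" for j
  have A: "A j \<in> sets borel" for j by (auto simp: A_def B split: prod.split)
  \<comment> \<open>\<open>d j\<close> is spent twice, once inside \<open>A j\<close> and once inside its complement.\<close>
  define d where "d j = e / 2 * (1 / 2) ^ Suc j" for j
  have d: "d j > 0" for j using e by (simp add: d_def)
  \<comment> \<open>Keeping one fixed point in all the sets below makes \<open>K\<close> nonempty.\<close>
  define t0 :: 'w where "t0 = undefined"
  have inner: "\<exists>K. compact K \<and> K \<subseteq> C \<and> (t0 \<in> C \<longrightarrow> t0 \<in> K) \<and> (\<forall>\<nu>\<in>\<N>. variation \<nu> (C - K) \<le> ennreal (d j))"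
    if C: "C \<in> sets borel" for C j
  proof -
    obtain K where K: "compact K" "K \<subseteq> C" "\<forall>\<nu>\<in>\<N>. variation \<nu> (C - K) \<le> ennreal (d j)"
    proof (rule uniform_inner_regularity[OF reg \<mu> null C])
      show "0 < ennreal (d j)" using d by simp
    qed
    have "variation \<nu> (C - (K \<union> {t0} \<inter> C)) \<le> ennreal (d j)" if "\<nu> \<in> \<N>" for \<nu>
    proof (rule order_trans[OF variation_mono K(3)[rule_format]])
      show "C - (K \<union> {t0} \<inter> C) \<in> sets borel" "C - K \<in> sets borel"
        using C K(1) by (auto simp: compact_imp_closed)
    qed (use reg that in auto)
    moreover have "compact (K \<union> {t0} \<inter> C)" using K(1) by (cases "t0 \<in> C") auto
    ultimately show ?thesis using K(2) by (intro exI[of _ "K \<union> {t0} \<inter> C"]) auto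
  qed
  have "\<exists>P. \<forall>j. compact (P j) \<and> P j \<subseteq> A j \<and> (t0 \<in> A j \<longrightarrow> t0 \<in> P j) \<and>
      (\<forall>\<nu>\<in>\<N>. variation \<nu> (A j - P j) \<le> ennreal (d j))"
    by (intro choice allI inner A)
  then obtain P where P: "\<And>j. compact (P j)" "\<And>j. P j \<subseteq> A j" "\<And>j. t0 \<in> A j \<Longrightarrow> t0 \<in> P j"
      "\<And>j \<nu>. \<nu> \<in> \<N> \<Longrightarrow> variation \<nu> (A j - P j) \<le> ennreal (d j)"
    by blast
  have cA: "- A j \<in> sets borel" for j using A by (rule borel_comp)
  have "\<exists>Q. \<forall>j. compact (Q j) \<and> Q j \<subseteq> - A j \<and> (t0 \<in> - A j \<longrightarrow> t0 \<in> Q j) \<and>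
      (\<forall>\<nu>\<in>\<N>. variation \<nu> (- A j - Q j) \<le> ennreal (d j))"
    by (intro choice allI inner cA)
  then obtain Q where Q: "\<And>j. compact (Q j)" "\<And>j. Q j \<subseteq> - A j" "\<And>j. t0 \<in> - A j \<Longrightarrow> t0 \<in> Q j"
      "\<And>j \<nu>. \<nu> \<in> \<N> \<Longrightarrow> variation \<nu> (- A j - Q j) \<le> ennreal (d j)"
    by blast
  define K where "K = (\<Inter>j. P j \<union> Q j)"
  have closed: "closed K" unfolding K_def using P(1) Q(1) by (intro closed_INT) (auto simp: compact_imp_closed)
  then have compK: "compact K" using compact_Int_closed[OF comp] by simp
  have Kb: "K \<in> sets borel" using closed by simp
  have t0: "t0 \<in> K" using P(3) Q(3) by (auto simp: K_def)
  have PQ: "P j \<in> sets borel" "Q j \<in> sets borel" for j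
    using P(1) Q(1) by (auto simp: compact_imp_closed)
  have small: "variation \<nu> (UNIV - K) \<le> ennreal e" if \<nu>: "\<nu> \<in> \<N>" for \<nu>
  proof -
    have "UNIV - K = (\<Union>j. UNIV - (P j \<union> Q j))" by (auto simp: K_def)
    also have "variation \<nu> \<dots> \<le> (\<Sum>j. variation \<nu> (UNIV - (P j \<union> Q j)))"
      by (rule variation_UN_le[OF reg[OF \<nu>]]) (use PQ in auto)
    also have "\<dots> \<le> (\<Sum>j. ennreal (e * (1 / 2) ^ Suc j))"
    proof (rule suminf_le)
      fix j
      have "variation \<nu> (UNIV - (P j \<union> Q j)) \<le> variation \<nu> ((A j - P j) \<union> (- A j - Q j))"
        using P(2)[of j] Q(2)[of j] A[of j] PQ[of j]
        by (intro variation_mono[OF reg[OF \<nu>]]) (auto simp: Compl_eq_Diff_UNIV)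
      also have "\<dots> \<le> variation \<nu> (A j - P j) + variation \<nu> (- A j - Q j)"
        using A[of j] PQ[of j] by (intro variation_Un_le[OF reg[OF \<nu>]]) (auto simp: Compl_eq_Diff_UNIV)
      also have "\<dots> \<le> ennreal (d j) + ennreal (d j)"
        by (intro add_mono P(4) Q(4) \<nu>)
      also have "\<dots> = ennreal (e * (1 / 2) ^ Suc j)"
        using d[of j] by (simp add: d_def flip: ennreal_plus)
      finally show "variation \<nu> (UNIV - (P j \<union> Q j)) \<le> ennreal (e * (1 / 2) ^ Suc j)" .
    qed auto
    also have "\<dots> = ennreal e"
      using sums_mult[OF power_half_series, of e] e by (intro suminf_ennreal_eq) auto
    finally show ?thesis .
  qed
  have "\<exists>g :: 'w \<Rightarrow> real. continuous_on UNIV g \<and> (\<forall>t. 0 \<le> g t \<and> g t \<le> 1) \<and> (\<forall>t\<in>P j. g t = 1) \<and> (\<forall>t\<in>Q j. g t = 0)" for j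
  proof -
    have "P j \<inter> Q j = {}" using P(2)[of j] Q(2)[of j] by auto
    from Urysohn_compact_Hausdorff[OF comp P(1) Q(1) this] show ?thesis by metis
  qed
  then obtain g :: "nat \<Rightarrow> 'w \<Rightarrow> real" where g: "\<And>j. continuous_on UNIV (g j)" "\<And>j t. 0 \<le> g j t" "\<And>j t. g j t \<le> 1"
      "\<And>j t. t \<in> P j \<Longrightarrow> g j t = 1" "\<And>j t. t \<in> Q j \<Longrightarrow> g j t = 0"
    by metis
  have code: "if t \<in> A j then t \<in> P j else t \<in> Q j" if "t \<in> K" for t j
    using that P(2)[of j] Q(2)[of j] by (auto simp: K_def)
  have gK: "g j t = (if t \<in> A j then 1 else 0)" if "t \<in> K" for j t
    using code[OF that, of j] g(4,5)[of t j] by (cases "t \<in> A j") auto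
  have ne: "K \<noteq> {}" using t0 by auto
  obtain S :: "nat \<Rightarrow> ('w \<Rightarrow>\<^sub>B 'x) \<Rightarrow>\<^sub>L ('w \<Rightarrow>\<^sub>C 'x)" where S: "\<forall>N. norm (S N) \<le> 1"
      "\<forall>f. (\<forall>e>0. \<exists>N. \<forall>s\<in>K. \<forall>t\<in>K. (\<forall>i<N. s \<in> A i \<longleftrightarrow> t \<in> A i) \<longrightarrow>
              norm (apply_bmeasfun f s - apply_bmeasfun f t) \<le> e) \<longrightarrow>
           (\<exists>h. (\<lambda>N. blinfun_apply (S N) f) \<longlonglongrightarrow> h \<and> (\<forall>t\<in>K. apply_bcontfun h t = apply_bmeasfun f t))"
    by (rule continuous_extension_operators[OF ne g(1-3) gK])
  have "\<exists>h. (\<lambda>N. blinfun_apply (S N) (x n)) \<longlonglongrightarrow> h \<and> (\<forall>t\<in>K. apply_bcontfun h t = apply_bmeasfun (x n) t)" for n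
  proof (rule S(2)[THEN spec, THEN mp], unfold dist_norm[symmetric], intro allI impI, rule finite_code_determines_value[OF compK])
    fix i
    have "t \<in> A i \<longleftrightarrow> t \<notin> Q i" if "t \<in> K" for t
      using code[OF that, of i] Q(2)[of i] by (cases "t \<in> A i") auto
    then have "K \<inter> A i = K \<inter> - Q i" by blast
    then show "openin (top_of_set K) (K \<inter> A i)"
      using compact_imp_closed[OF Q(1)[of i]] by (simp add: open_Compl openin_open_Int)
  next
    fix r :: real and t assume "r > 0"
    then obtain i where i: "t \<in> B n i"
        "\<forall>s\<in>B n i. \<forall>s'\<in>B n i. dist (apply_bmeasfun (x n) s) (apply_bmeasfun (x n) s') \<le> r"
      using B(2)[OF \<open>r > 0\<close>, of t n] by blast
    have Ai: "A (prod_encode (n, i)) = B n i" by (simp add: A_def)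
    show "\<exists>j. t \<in> A j \<and> (\<forall>s\<in>A j. \<forall>s'\<in>A j. dist (apply_bmeasfun (x n) s) (apply_bmeasfun (x n) s') \<le> r)"
      by (rule exI[of _ "prod_encode (n, i)"], unfold Ai) (use i in blast)
  qed
  then have "\<exists>h. \<forall>n. (\<lambda>N. blinfun_apply (S N) (x n)) \<longlonglongrightarrow> h n \<and>
      (\<forall>t\<in>K. apply_bcontfun (h n) t = apply_bmeasfun (x n) t)"
    by (intro choice allI)
  then obtain h where h: "\<And>n. (\<lambda>N. blinfun_apply (S N) (x n)) \<longlonglongrightarrow> h n"
      "\<And>n t. t \<in> K \<Longrightarrow> apply_bcontfun (h n) t = apply_bmeasfun (x n) t"
    by blast
  obtain E :: "(('w \<Rightarrow>\<^sub>C 'x) \<Rightarrow>\<^sub>L real) \<Rightarrow>\<^sub>L (('w \<Rightarrow>\<^sub>B 'x) \<Rightarrow>\<^sub>L real)"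
    where E: "\<forall>f h \<Phi>. (\<lambda>N. blinfun_apply (S N) f) \<longlonglongrightarrow> h \<longrightarrow>
           blinfun_apply (blinfun_apply E \<Phi>) f = blinfun_apply \<Phi> h"
    by (rule dual_lifting_of_approximating_operators[OF S(1)[rule_format]])
  have nh: "norm (h n) \<le> norm (x n)" for n
  proof (rule tendsto_upperbound[OF tendsto_norm[OF h(1)]])
    have "norm (blinfun_apply (S N) (x n)) \<le> norm (x n)" for N
      using norm_blinfun[of "S N" "x n"] mult_right_mono[OF S(1)[rule_format, of N] norm_ge_zero[of "x n"]] by simp
    then show "\<forall>\<^sub>F N in sequentially. norm (blinfun_apply (S N) (x n)) \<le> norm (x n)" by simp
  qed simp
  show ?thesis by (rule that[OF Kb small h(2) nh E[rule_format, OF h(1)]])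
qed


section \<open>The operator and its extension\<close>

text \<open>
  For each \<open>\<psi>\<close> the number \<open>\<psi> (T h - That f)\<close> is an integral of \<open>h - f\<close>, which lives off \<open>K\<close>.
  With \<open>K = UNIV\<close> and \<open>e = 0\<close> this says that \<open>That\<close> extends \<open>T\<close>.
\<close>

lemma norm_extension_diff_le:
  fixes T :: "('w::t2_space \<Rightarrow>\<^sub>C 'x::banach) \<Rightarrow>\<^sub>L 'y::banach"
  assumes comp: "compact (UNIV :: 'w set)"
    and T: "representing_measure T m" and That: "bounded_Borel_extension m That"
    and K: "K \<in> sets borel" and eq: "\<And>t. t \<in> K \<Longrightarrow> apply_bcontfun h t = apply_bmeasfun f t"
    and e: "0 \<le> e" "\<And>\<psi>. norm \<psi> \<le> 1 \<Longrightarrow> variation (functional_measure m \<psi>) (UNIV - K) \<le> ennreal e"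
  shows "norm (blinfun_apply T h - blinfun_apply That f) \<le> (norm h + norm f) * e"
proof (rule norm_le_if_functionals_le)
  fix \<psi> :: "'y \<Rightarrow>\<^sub>L real" assume \<psi>: "norm \<psi> \<le> 1"
  let ?c = "norm h + norm f"
  have c: "norm (apply_bcontfun h t - apply_bmeasfun f t) \<le> ?c" for t
    using norm_bounded[of h t] norm_bmeasfun_upper[of f t]
    by (intro order_trans[OF norm_triangle_ineq4] add_mono)
  have I: "has_dual_integral (functional_measure m \<psi>) (apply_bcontfun h) (blinfun_apply \<psi> (blinfun_apply T h))"
      "has_dual_integral (functional_measure m \<psi>) (apply_bmeasfun f) (blinfun_apply \<psi> (blinfun_apply That f))"
    using T That by (auto simp: representing_measure_def bounded_Borel_extension_def has_operator_integral_def)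
  have "ennreal \<bar>blinfun_apply \<psi> (blinfun_apply T h) - blinfun_apply \<psi> (blinfun_apply That f)\<bar>
      \<le> ennreal ?c * variation (functional_measure m \<psi>) (UNIV - K)"
    using T by (intro has_dual_integral_diff_le[OF _ bcontfun_imp_bmeasfun[OF comp] apply_bmeasfun I K eq c])
      (auto simp: representing_measure_def)
  also have "\<dots> \<le> ennreal ?c * ennreal e" by (intro mult_left_mono e(2) \<psi>) simp
  also have "\<dots> = ennreal (?c * e)" using e(1) by (simp add: ennreal_mult')
  finally show "\<bar>blinfun_apply \<psi> (blinfun_apply T h - blinfun_apply That f)\<bar> \<le> ?c * e"
    using e(1) by (simp add: blinfun.diff_right)
qed

theorem theorem4p1:
  fixes p :: real
    and T :: "('w::t2_space \<Rightarrow>\<^sub>C 'x::banach) \<Rightarrow>\<^sub>L 'y::banach"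
    and m :: "'w set \<Rightarrow> 'x \<Rightarrow>\<^sub>L ('y \<Rightarrow>\<^sub>L real) \<Rightarrow>\<^sub>L real"
    and That :: "('w \<Rightarrow>\<^sub>B 'x) \<Rightarrow>\<^sub>L 'y"
  assumes "1 \<le> p"
    and "compact (UNIV :: 'w set)"
    and "representing_measure T m"
    and "strongly_bounded_measure m"
    and "bounded_Borel_extension m That"
  shows "DP_p_convergent p T \<longleftrightarrow> DP_p_convergent p That"
proof
  note comp = assms(2) and diff_le = norm_extension_diff_le[OF assms(2,3,5)]
  have reg: "regular_bv_measure (functional_measure m \<psi>)" for \<psi>
    using assms(3) by (simp add: representing_measure_def)
  assume T: "DP_p_convergent p T"
  show "DP_p_convergent p That"
    unfolding DP_p_convergent_def
  proof (intro allI impI, elim conjE)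
    fix x :: "nat \<Rightarrow> 'w \<Rightarrow>\<^sub>B 'x"
    assume x: "weakly_p_summable p x" "Dunford_Pettis_set (range x)"
    obtain c where c: "c > 0" "\<And>n. norm (x n) \<le> c"
      using x(2) unfolding Dunford_Pettis_set_def bounded_pos by auto
    show "(\<lambda>n. blinfun_apply That (x n)) \<longlonglongrightarrow> 0"
    proof (rule LIMSEQ_I)
      fix r :: real assume r: "r > 0"
      \<comment> \<open>This makes the error \<open>2 c e\<close> equal to half of \<open>r\<close>.\<close>
      define e where "e = r / (4 * c)"
      have e: "e > 0" using r c by (simp add: e_def)
      obtain K h and E :: "(('w \<Rightarrow>\<^sub>C 'x) \<Rightarrow>\<^sub>L real) \<Rightarrow>\<^sub>L (('w \<Rightarrow>\<^sub>B 'x) \<Rightarrow>\<^sub>L real)"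
        where K: "K \<in> sets borel"
            "\<And>\<nu>. \<nu> \<in> functional_measure m ` {\<psi>. norm \<psi> \<le> 1} \<Longrightarrow> variation \<nu> (UNIV - K) \<le> ennreal e"
          and h: "\<And>n t. t \<in> K \<Longrightarrow> apply_bcontfun (h n) t = apply_bmeasfun (x n) t"
            "\<And>n. norm (h n) \<le> norm (x n)"
          and E: "\<And>\<Phi> n. blinfun_apply (blinfun_apply E \<Phi>) (x n) = blinfun_apply \<Phi> (h n)"
      proof (rule continuous_representatives[where \<N> = "functional_measure m ` {\<psi>. norm \<psi> \<le> 1}"
            and \<mu> = "semivariation m" and e = e and x = x, OF comp])
        show "\<And>B :: nat \<Rightarrow> 'w set. range B \<subseteq> sets borel \<Longrightarrow> disjoint_family B \<Longrightarrow>
            (\<lambda>n. semivariation m (B n)) \<longlonglongrightarrow> 0"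
          using assms(4) by (simp add: strongly_bounded_measure_def)
      qed (use reg e in \<open>auto intro: variation_functional_measure_le_semivariation\<close>)
      have hc: "norm (h n) \<le> c" for n using h(2) c(2) order_trans by blast
      have "weakly_p_summable p h" by (rule weakly_p_summable_dual_lift[OF E x(1)])
      moreover have "Dunford_Pettis_set (range h)"
        by (rule Dunford_Pettis_set_dual_lift[OF E x(2)]) (use hc in \<open>auto simp: bounded_iff\<close>)
      ultimately have "(\<lambda>n. blinfun_apply T (h n)) \<longlonglongrightarrow> 0"
        using T unfolding DP_p_convergent_def by blast
      then obtain N where N: "\<And>n. n \<ge> N \<Longrightarrow> norm (blinfun_apply T (h n)) < r / 2"
        using LIMSEQ_D[of _ 0 "r / 2"] r by auto
      have "norm (blinfun_apply That (x n)) < r" if "n \<ge> N" for n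
      proof -
        have "norm (blinfun_apply T (h n) - blinfun_apply That (x n)) \<le> (norm (h n) + norm (x n)) * e"
          using e K(2) by (intro diff_le[OF K(1) h(1)]) auto
        also have "\<dots> \<le> (c + c) * e" using e hc c(2) by (intro mult_right_mono add_mono) auto
        also have "\<dots> = r / 2" using c(1) by (simp add: e_def)
        finally show ?thesis
          using N[OF that] norm_triangle_ineq2[of "blinfun_apply That (x n)" "blinfun_apply T (h n)"]
          by (simp add: norm_minus_commute)
      qed
      then show "\<exists>N. \<forall>n\<ge>N. norm (blinfun_apply That (x n) - 0) < r" by auto
    qed
  qed
next
  note comp = assms(2) and diff_le = norm_extension_diff_le[OF assms(2,3,5)]
  assume That: "DP_p_convergent p That"
  define J0 where "J0 h = Bmeasfun (apply_bcontfun h)" for h :: "'w \<Rightarrow>\<^sub>C 'x"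
  have J0: "apply_bmeasfun (J0 h) = apply_bcontfun h" for h
    unfolding J0_def by (rule Bmeasfun_inverse[OF bcontfun_imp_bmeasfun[OF comp]])
  have lin: "bounded_linear J0"
  proof (rule bounded_linear_intro[where K = 1])
    show "norm (J0 h) \<le> norm h * 1" for h
      by (rule norm_bmeasfun_least) (simp add: J0 norm_bounded)
  qed (auto intro!: bmeasfun_eqI simp: J0 plus_bmeasfun.rep_eq scaleR_bmeasfun.rep_eq)
  define J where "J = Blinfun J0"
  have J: "blinfun_apply J h = J0 h" for h
    by (simp add: J_def bounded_linear_Blinfun_apply[OF lin])
  have TJ: "blinfun_apply T h = blinfun_apply That (J0 h)" for h
  proof -
    have "variation (functional_measure m \<psi>) {} \<le> ennreal 0" for \<psi> :: "'y \<Rightarrow>\<^sub>L real"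
      using emeasure_variation_measure[of "functional_measure m \<psi>" "{}"] assms(3)
      by (simp add: representing_measure_def)
    then show ?thesis
      using diff_le[of UNIV h "J0 h" 0] by (simp add: J0)
  qed
  have E: "blinfun_apply (blinfun_apply (Blinfun (\<lambda>\<Phi>. \<Phi> o\<^sub>L J)) \<Phi>) h = blinfun_apply \<Phi> (J0 h)"
    for \<Phi> :: "('w \<Rightarrow>\<^sub>B 'x) \<Rightarrow>\<^sub>L real" and h
    by (subst bounded_linear_Blinfun_apply) (auto simp: J intro!: bounded_linear_intros)
  show "DP_p_convergent p T"
    unfolding DP_p_convergent_def
  proof (intro allI impI, elim conjE)
    fix x :: "nat \<Rightarrow> 'w \<Rightarrow>\<^sub>C 'x"
    assume x: "weakly_p_summable p x" "Dunford_Pettis_set (range x)"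
    have "weakly_p_summable p (\<lambda>n. J0 (x n))"
      by (rule weakly_p_summable_dual_lift[OF E x(1)])
    moreover have "Dunford_Pettis_set (range (\<lambda>n. J0 (x n)))"
    proof (rule Dunford_Pettis_set_dual_lift[OF E x(2)])
      have "bounded (J0 ` range x)"
        using x(2) lin by (intro bounded_linear_image) (auto simp: Dunford_Pettis_set_def)
      then show "bounded (range (\<lambda>n. J0 (x n)))" by (simp add: image_image)
    qed
    ultimately show "(\<lambda>n. blinfun_apply T (x n)) \<longlonglongrightarrow> 0"
      using That unfolding DP_p_convergent_def TJ by blast
  qed
qed

end
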